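(* Let $\mathcal P\subseteq \mathbb N\times\mathbb N$ be a pattern. The following are equivalent: (1) $\mathcal P$ is Schur bounded; (2) $\mathcal P$ is the union of a row finite set and a column finite set; (3) $\displaystyle\sup_{R,C\subseteq\mathbb N \text{ finite, not both empty}}\frac{|\mathcal P\cap(R\times C)|}{|R|+|C|}<\infty$. Moreover, when these hold, let $m$ be the least integer dominating the supremum in (3). Then $m$ is also the least integer $k$ such that $\mathcal P$ is the union of a set row bounded by $k$ and a set column bounded by $k$, and the Schur bound satisfies \[\frac{\sqrt m}{4}\le \mathfrak s(\mathcal P)\le 2\sqrt m.\]
   Context: For a (finite or infinite) matrix $A=[a_{ij}]$, the Schur multiplier $S_A$ acts on bounded operators $T=[t_{ij}]$ on $\ell^2$ by $S_A(T)=[a_{ij}t_{ij}]$; $\|A\|_m$ denotes the norm of $S_A$ as a map on $\mathcal B(\ell^2)$ (possibly $+\infty$). A pattern is a subset $\mathcal P\subseteq\mathbb N\times\mathbb N$; a matrix is supported on $\mathcal P$ if its nonzero entries lie in $\mathcal P$. $\mathcal S(\mathcal P)$ is the set of matrices supported on $\mathcal P$ with all entries of modulus at most $1$. $\mathcal P$ is Schur bounded if every $X\in\mathcal S(\mathcal P)$ gives a bounded Schur multiplier, and $\mathfrak s(\mathcal P)=\sup_{X\in\mathcal S(\mathcal P)}\|X\|_m$. A pattern is row bounded by $k$ if each row contains at most $k$ elements of the pattern, and row finite if it is row bounded by some $k\in\mathbb N$; column bounded by $k$ and column finite are defined analogously with columns. *)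

theory Defs
  imports Complex_Main "HOL-Library.Extended_Real"
begin

text \<open>Infinite matrices over nat x nat with complex entries. The operator norm on l2
  of the operator given by a matrix T is the supremum of the bilinear form
  over finitely supported unit vectors (value in ereal; infinite iff T is unbounded).\<close>

type_synonym cmat = "nat \<Rightarrow> nat \<Rightarrow> complex"

definition mat_norm :: "cmat \<Rightarrow> ereal" where
  "mat_norm T = (SUP (n, x, y) \<in> {(n::nat, x::nat \<Rightarrow> complex, y::nat \<Rightarrow> complex).
       (\<Sum>j<n. (cmod (x j))\<^sup>2) \<le> 1 \<and> (\<Sum>i<n. (cmod (y i))\<^sup>2) \<le> 1}.
     ereal (cmod (\<Sum>i<n. \<Sum>j<n. cnj (y i) * T i j * x j)))"

definition schur_norm :: "cmat \<Rightarrow> ereal" where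
  "schur_norm A = (SUP T \<in> {T. mat_norm T \<le> 1}. mat_norm (\<lambda>i j. A i j * T i j))"

definition supported_on :: "cmat \<Rightarrow> (nat \<times> nat) set \<Rightarrow> bool" where
  "supported_on X P \<longleftrightarrow> (\<forall>i j. X i j \<noteq> 0 \<longrightarrow> (i, j) \<in> P)"

definition schur_class :: "(nat \<times> nat) set \<Rightarrow> cmat set" where
  "schur_class P = {X. supported_on X P \<and> (\<forall>i j. cmod (X i j) \<le> 1)}"

definition schur_bounded :: "(nat \<times> nat) set \<Rightarrow> bool" where
  "schur_bounded P \<longleftrightarrow> (\<forall>X \<in> schur_class P. schur_norm X < \<infinity>)"

definition schur_bound :: "(nat \<times> nat) set \<Rightarrow> ereal" where
  "schur_bound P = (SUP X \<in> schur_class P. schur_norm X)"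

definition row_bounded :: "(nat \<times> nat) set \<Rightarrow> nat \<Rightarrow> bool" where
  "row_bounded Q k \<longleftrightarrow> (\<forall>i. finite {j. (i, j) \<in> Q} \<and> card {j. (i, j) \<in> Q} \<le> k)"

definition col_bounded :: "(nat \<times> nat) set \<Rightarrow> nat \<Rightarrow> bool" where
  "col_bounded Q k \<longleftrightarrow> (\<forall>j. finite {i. (i, j) \<in> Q} \<and> card {i. (i, j) \<in> Q} \<le> k)"

definition row_finite :: "(nat \<times> nat) set \<Rightarrow> bool" where
  "row_finite Q \<longleftrightarrow> (\<exists>k. row_bounded Q k)"

definition col_finite :: "(nat \<times> nat) set \<Rightarrow> bool" where
  "col_finite Q \<longleftrightarrow> (\<exists>k. col_bounded Q k)"

definition pattern_density :: "(nat \<times> nat) set \<Rightarrow> ereal" where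
  "pattern_density P = (SUP (R, C) \<in> {(R, C). finite R \<and> finite C \<and> (R \<noteq> {} \<or> C \<noteq> {})}.
      ereal (real (card (P \<inter> (R \<times> C))) / (real (card R) + real (card C))))"

end

theory Submission
  imports Defs "HOL-Analysis.Analysis" "HOL-Real_Asymp.Real_Asymp"
begin

text \<open>
  A matrix supported on a row bounded pattern has rows of norm at most \<open>\<surd>k\<close>, and the columns of a
  contraction have norm at most \<open>1\<close>; Cauchy-Schwarz bounds the Schur multiplier, and splitting the
  pattern gives the upper bound.

  Splitting a pattern of density at most \<open>m\<close> means assigning each of its elements to its row or to
  its column so that nothing is used more than \<open>m\<close> times. Rado's argument for Hall's theorem
  removes one of the two options of a single element, and works for infinite patterns because it only
  involves finite subsets.

  For the lower bound let \<open>D\<close> be a finite part of the pattern with \<open>N\<close> elements in \<open>r\<close> rows and \<open>c\<close>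
  columns. A random choice of signs \<open>A\<close> on \<open>D\<close> satisfies \<open>\<Sum> A\<^sub>i\<^sub>j a\<^sub>i b\<^sub>j \<le> L\<close> for all \<open>a\<close>, \<open>b\<close> bounded
  by \<open>1\<close>, with \<open>L = \<surd>(2 ln 2 N (r + c))\<close>. Let \<open>F\<close> be the maximum of \<open>\<Sum> A\<^sub>i\<^sub>j \<rho>\<^sub>i\<^sub>j\<close> over the limits of
  kernels \<open>\<rho>\<^sub>i\<^sub>j = \<langle>u\<^sub>i, v\<^sub>j\<rangle>\<close> of unit vectors. Grothendieck's inequality \<open>F \<le> K L\<close> follows from
  rounding \<open>u\<close> to the sine of a Gaussian: the expectation of the product of two such sines is
  \<open>e\<^sup>-\<^sup>\<tau> sinh(\<tau>\<rho>)\<close>, and the higher powers of \<open>\<rho>\<close> in the series are again such kernels. This gives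
  \<open>K = e\<^sup>\<tau> / (2\<tau> - sinh \<tau>)\<close>, which is below \<open>3.15\<close> for \<open>\<tau> = 3/4\<close>. Perturbing a maximal kernel by a rank
  one kernel shows \<open>\<Sum> A\<^sub>i\<^sub>j a\<^sub>i b\<^sub>j \<le> (\<Sum> \<kappa>\<^sub>i a\<^sub>i\<^sup>2 + \<Sum> \<mu>\<^sub>j b\<^sub>j\<^sup>2) / 2\<close>, where \<open>\<kappa>\<close> and \<open>\<mu>\<close> are the row and column
  sums of \<open>A\<^sub>i\<^sub>j \<rho>\<^sub>i\<^sub>j\<close>. Hence the matrix with entries \<open>A\<^sub>i\<^sub>j / \<surd>(\<kappa>\<^sub>i \<mu>\<^sub>j)\<close> is a contraction, whereas
  its Schur product with \<open>A\<close>, tested on \<open>\<surd>(\<kappa>/F)\<close> and \<open>\<surd>(\<mu>/F)\<close>, has norm at least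
  \<open>N / F \<ge> \<surd>(N / (15 (r + c)))\<close>.
  This suffices when \<open>m > 16\<close>; for smaller \<open>m\<close> a single entry does.
\<close>

section \<open>Schur multipliers of row and column bounded patterns\<close>

lemma mat_norm_le_iff:
  "mat_norm T \<le> ereal c \<longleftrightarrow>
    (\<forall>n x y. (\<Sum>j<n. (cmod (x j))\<^sup>2) \<le> 1 \<longrightarrow> (\<Sum>i<n. (cmod (y i))\<^sup>2) \<le> 1 \<longrightarrow>
      cmod (\<Sum>i<n. \<Sum>j<n. cnj (y i) * T i j * x j) \<le> c)"
  unfolding mat_norm_def by (auto simp: SUP_le_iff)

lemma mat_norm_ge_form:
  assumes "(\<Sum>j<n. (cmod (x j))\<^sup>2) \<le> 1" "(\<Sum>i<n. (cmod (y i))\<^sup>2) \<le> 1"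
  shows "ereal (cmod (\<Sum>i<n. \<Sum>j<n. cnj (y i) * T i j * x j)) \<le> mat_norm T"
  unfolding mat_norm_def by (rule SUP_upper2[where i="(n, x, y)"]) (use assms in auto)

lemma mat_norm_nonneg: "0 \<le> mat_norm T"
  using mat_norm_ge_form[where n=0 and T=T] by (simp add: zero_ereal_def)

text \<open>The form of the transpose is the form of \<open>T\<close> with the two test vectors
  exchanged and conjugated.\<close>

lemma mat_norm_transpose_le:
  assumes "mat_norm T \<le> ereal c"
  shows "mat_norm (\<lambda>i j. T j i) \<le> ereal c"
  unfolding mat_norm_le_iff
proof (intro allI impI)
  fix n and x y :: "nat \<Rightarrow> complex"
  assume "(\<Sum>j<n. (cmod (x j))\<^sup>2) \<le> 1" "(\<Sum>i<n. (cmod (y i))\<^sup>2) \<le> 1"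
  then have "cmod (\<Sum>i<n. \<Sum>j<n. cnj (cnj (x i)) * T i j * cnj (y j)) \<le> c"
    using assms[unfolded mat_norm_le_iff, rule_format, where n=n and x="\<lambda>i. cnj (y i)" and y="\<lambda>i. cnj (x i)"]
    by simp
  moreover have "(\<Sum>i<n. \<Sum>j<n. cnj (cnj (x i)) * T i j * cnj (y j)) =
      (\<Sum>i<n. \<Sum>j<n. cnj (y i) * T j i * x j)"
    by (subst sum.swap) (simp add: mult_ac)
  ultimately show "cmod (\<Sum>i<n. \<Sum>j<n. cnj (y i) * T j i * x j) \<le> c" by simp
qed

lemma schur_norm_ge:
  "mat_norm T \<le> 1 \<Longrightarrow> mat_norm (\<lambda>i j. A i j * T i j) \<le> schur_norm A"
  unfolding schur_norm_def by (rule SUP_upper) simp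

lemma schur_norm_nonneg: "0 \<le> schur_norm A"
proof -
  have "mat_norm (\<lambda>i j. 0) \<le> ereal 1" by (simp add: mat_norm_le_iff)
  then show ?thesis
    using schur_norm_ge[of "\<lambda>i j. 0" A] mat_norm_nonneg order_trans
    by (metis one_ereal_def)
qed

text \<open>The \<open>j\<close>-th column is the image of the \<open>j\<close>-th basis vector, so
  the form is tested on that vector and on the normalised column.\<close>

lemma column_norm_le_1:
  assumes "mat_norm T \<le> 1"
  shows "(\<Sum>i<n. (cmod (T i j))\<^sup>2) \<le> 1"
proof -
  \<comment> \<open>The truncation must reach past \<open>j\<close> for the form to see that
    column.\<close>
  define N where "N = max n (Suc j)"
  define S where "S = (\<Sum>i<N. (cmod (T i j))\<^sup>2)"
  have "S \<le> 1"
  proof (cases "S = 0")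
    case False
    then have S: "S > 0" unfolding S_def by (metis less_eq_real_def sum_nonneg zero_le_power2)
    define y where "y i = T i j / of_real (sqrt S)" for i
    define x :: "nat \<Rightarrow> complex" where "x i = (if i = j then 1 else 0)" for i
    have "(\<Sum>k<N. (cmod (x k))\<^sup>2) = (\<Sum>k<N. if k = j then 1 else 0)"
      by (rule sum.cong) (auto simp: x_def)
    then have x: "(\<Sum>k<N. (cmod (x k))\<^sup>2) \<le> 1" by (simp add: sum.delta)
    have "(\<Sum>i<N. (cmod (y i))\<^sup>2) = S / S"
      using S unfolding y_def S_def[symmetric]
      by (simp add: norm_divide power_divide sum_divide_distrib[symmetric] S_def[symmetric])
    then have y: "(\<Sum>i<N. (cmod (y i))\<^sup>2) \<le> 1" using S by simp
    have "(\<Sum>i<N. \<Sum>k<N. cnj (y i) * T i k * x k) = (\<Sum>i<N. cnj (y i) * T i j)"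
    proof (rule sum.cong[OF refl])
      fix i
      have "(\<Sum>k<N. cnj (y i) * T i k * x k) = (\<Sum>k<N. if k = j then cnj (y i) * T i k else 0)"
        by (rule sum.cong) (auto simp: x_def)
      also have "\<dots> = cnj (y i) * T i j" by (simp add: N_def)
      finally show "(\<Sum>k<N. cnj (y i) * T i k * x k) = cnj (y i) * T i j" .
    qed
    also have "\<dots> = (\<Sum>i<N. of_real ((cmod (T i j))\<^sup>2 / sqrt S))"
      by (rule sum.cong) (simp_all add: y_def complex_norm_square mult.commute del: of_real_power)
    also have "\<dots> = of_real (S / sqrt S)"
      by (simp only: S_def of_real_sum[symmetric] sum_divide_distrib)
    finally have "cmod (\<Sum>i<N. \<Sum>k<N. cnj (y i) * T i k * x k) = S / sqrt S"
      using S by (simp add: norm_divide)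
    moreover have "cmod (\<Sum>i<N. \<Sum>k<N. cnj (y i) * T i k * x k) \<le> 1"
      using assms x y by (simp only: one_ereal_def mat_norm_le_iff)
    ultimately have "sqrt S \<le> 1" using S by (simp add: real_div_sqrt)
    then show ?thesis by simp
  qed simp
  moreover have "(\<Sum>i<n. (cmod (T i j))\<^sup>2) \<le> S"
    unfolding S_def by (rule sum_mono2) (auto simp: N_def)
  ultimately show ?thesis by simp
qed

text \<open>Cauchy-Schwarz over index pairs, with \<open>T\<close> grouped with \<open>x\<close> and
  \<open>X\<close> with \<open>y\<close>: one factor sums the columns of \<open>T\<close>, the other
  the rows of \<open>X\<close>.\<close>

lemma mat_norm_schur_row_bounded:
  assumes X: "supported_on X Q" "\<And>i j. cmod (X i j) \<le> 1" and Q: "row_bounded Q k"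
    and T: "mat_norm T \<le> 1"
  shows "mat_norm (\<lambda>i j. X i j * T i j) \<le> ereal (sqrt (real k))"
  unfolding mat_norm_le_iff
proof (intro allI impI)
  fix n and x y :: "nat \<Rightarrow> complex"
  assume x: "(\<Sum>j<n. (cmod (x j))\<^sup>2) \<le> 1" and y: "(\<Sum>i<n. (cmod (y i))\<^sup>2) \<le> 1"
  let ?I = "{..<n} \<times> {..<n}"
  let ?a = "\<lambda>(i, j). cmod (x j) * cmod (T i j)" and ?b = "\<lambda>(i, j). cmod (y i) * cmod (X i j)"
  have "cmod (\<Sum>i<n. \<Sum>j<n. cnj (y i) * (X i j * T i j) * x j) \<le>
      (\<Sum>i<n. \<Sum>j<n. cmod (cnj (y i) * (X i j * T i j) * x j))"
    by (intro sum_norm_le norm_sum)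
  also have "\<dots> = (\<Sum>p\<in>?I. ?a p * ?b p)"
    by (simp add: sum.cartesian_product norm_mult mult_ac split_def)
  also have "\<dots> \<le> sqrt ((\<Sum>p\<in>?I. (?a p)\<^sup>2) * (\<Sum>p\<in>?I. (?b p)\<^sup>2))"
    by (rule real_le_rsqrt) (rule Cauchy_Schwarz_ineq_sum)
  also have "\<dots> \<le> sqrt (1 * real k)"
  proof (rule real_sqrt_le_mono, rule mult_mono)
    have "(\<Sum>p\<in>?I. (?a p)\<^sup>2) = (\<Sum>i<n. \<Sum>j<n. (cmod (x j))\<^sup>2 * (cmod (T i j))\<^sup>2)"
      by (simp add: sum.cartesian_product power_mult_distrib split_def)
    also have "\<dots> = (\<Sum>j<n. (cmod (x j))\<^sup>2 * (\<Sum>i<n. (cmod (T i j))\<^sup>2))"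
      by (subst sum.swap) (simp add: sum_distrib_left)
    also have "\<dots> \<le> (\<Sum>j<n. (cmod (x j))\<^sup>2 * 1)"
      by (intro sum_mono mult_left_mono column_norm_le_1 T) auto
    finally show "(\<Sum>p\<in>?I. (?a p)\<^sup>2) \<le> 1" using x by simp
    have row: "(\<Sum>j<n. (cmod (X i j))\<^sup>2) \<le> real k" for i
    proof -
      have fin: "finite {j. (i, j) \<in> Q}" and "card {j. (i, j) \<in> Q} \<le> k"
        using Q by (auto simp: row_bounded_def)
      have "(\<Sum>j<n. (cmod (X i j))\<^sup>2) \<le> (\<Sum>j<n. if (i, j) \<in> Q then 1 else 0)"
        using X by (intro sum_mono) (auto simp: supported_on_def power_le_one)
      also have "\<dots> = real (card ({..<n} \<inter> {j. (i, j) \<in> Q}))"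
        by (simp add: sum.If_cases)
      also have "\<dots> \<le> real (card {j. (i, j) \<in> Q})"
        using fin by (simp add: card_mono)
      also have "\<dots> \<le> real k" using Q by (simp add: row_bounded_def)
      finally show ?thesis .
    qed
    have "(\<Sum>p\<in>?I. (?b p)\<^sup>2) = (\<Sum>i<n. (cmod (y i))\<^sup>2 * (\<Sum>j<n. (cmod (X i j))\<^sup>2))"
      by (simp add: sum.cartesian_product power_mult_distrib split_def sum_distrib_left)
    also have "\<dots> \<le> (\<Sum>i<n. (cmod (y i))\<^sup>2 * real k)"
      by (intro sum_mono mult_left_mono row) auto
    also have "\<dots> \<le> 1 * real k"
      unfolding sum_distrib_right[symmetric] using y by (intro mult_right_mono) auto
    finally show "(\<Sum>p\<in>?I. (?b p)\<^sup>2) \<le> real k" by simp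
  qed (auto intro: sum_nonneg)
  finally show "cmod (\<Sum>i<n. \<Sum>j<n. cnj (y i) * (X i j * T i j) * x j) \<le> sqrt (real k)" by simp
qed

lemma mat_norm_schur_col_bounded:
  assumes X: "supported_on X Q" "\<And>i j. cmod (X i j) \<le> 1" and Q: "col_bounded Q k"
    and T: "mat_norm T \<le> 1"
  shows "mat_norm (\<lambda>i j. X i j * T i j) \<le> ereal (sqrt (real k))"
proof -
  have "mat_norm (\<lambda>i j. X j i * T j i) \<le> ereal (sqrt (real k))"
  proof (rule mat_norm_schur_row_bounded)
    show "supported_on (\<lambda>i j. X j i) (Q\<inverse>)" using X by (simp add: supported_on_def)
    show "row_bounded (Q\<inverse>) k" using Q by (simp add: row_bounded_def col_bounded_def)
    show "mat_norm (\<lambda>i j. T j i) \<le> 1"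
      using mat_norm_transpose_le[of T 1] T by (simp add: one_ereal_def)
  qed (rule X)
  then show ?thesis by (rule mat_norm_transpose_le)
qed

text \<open>Entries in \<open>Q1\<close> all go to \<open>X1\<close>, so \<open>X2\<close> is
  supported on \<open>Q2\<close> even if the two sets overlap; each part contributes
  \<open>sqrt k\<close>.\<close>

lemma schur_norm_le_of_union:
  assumes X: "X \<in> schur_class (Q1 \<union> Q2)" and Q1: "row_bounded Q1 k" and Q2: "col_bounded Q2 k"
  shows "schur_norm X \<le> ereal (2 * sqrt (real k))"
  unfolding schur_norm_def
proof (rule SUP_least, clarify)
  fix T assume T: "mat_norm T \<le> 1"
  define X1 where "X1 i j = (if (i, j) \<in> Q1 then X i j else 0)" for i j
  define X2 where "X2 i j = (if (i, j) \<in> Q1 then 0 else X i j)" for i j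
  have 1: "mat_norm (\<lambda>i j. X1 i j * T i j) \<le> ereal (sqrt (real k))"
    by (rule mat_norm_schur_row_bounded[OF _ _ Q1 T])
       (use X in \<open>auto simp: X1_def supported_on_def schur_class_def\<close>)
  have 2: "mat_norm (\<lambda>i j. X2 i j * T i j) \<le> ereal (sqrt (real k))"
    by (rule mat_norm_schur_col_bounded[OF _ _ Q2 T])
       (use X in \<open>auto simp: X2_def supported_on_def schur_class_def\<close>)
  show "mat_norm (\<lambda>i j. X i j * T i j) \<le> ereal (2 * sqrt (real k))"
    unfolding mat_norm_le_iff
  proof (intro allI impI)
    fix n and x y :: "nat \<Rightarrow> complex"
    assume x: "(\<Sum>j<n. (cmod (x j))\<^sup>2) \<le> 1" and y: "(\<Sum>i<n. (cmod (y i))\<^sup>2) \<le> 1"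
    have "(\<Sum>i<n. \<Sum>j<n. cnj (y i) * (X i j * T i j) * x j) =
       (\<Sum>i<n. \<Sum>j<n. cnj (y i) * (X1 i j * T i j) * x j) +
       (\<Sum>i<n. \<Sum>j<n. cnj (y i) * (X2 i j * T i j) * x j)"
      unfolding sum.distrib[symmetric] by (intro sum.cong) (auto simp: X1_def X2_def)
    also have "cmod \<dots> \<le> sqrt (real k) + sqrt (real k)"
      using 1 2 x y unfolding mat_norm_le_iff by (intro norm_triangle_mono) blast+
    finally show "cmod (\<Sum>i<n. \<Sum>j<n. cnj (y i) * (X i j * T i j) * x j) \<le> 2 * sqrt (real k)"
      by simp
  qed
qed

text \<open>Schur multiplication only rescales a matrix unit. This crude bound serves patterns of
  small density.\<close>

lemma schur_norm_ge_entry: "ereal (cmod (X i j)) \<le> schur_norm X"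
proof -
  define T :: cmat where "T k l = (if k = i \<and> l = j then 1 else 0)" for k l
  define n where "n = Suc (max i j)"
  define e :: "nat \<Rightarrow> nat \<Rightarrow> complex" where "e k l = (if l = k then 1 else 0)" for k l
  have form: "(\<Sum>k<N. \<Sum>l<N. cnj (y k) * (c * T k l) * x l) =
      (if i < N \<and> j < N then cnj (y i) * c * x j else 0)" for N x y c
  proof -
    have "(\<Sum>k<N. \<Sum>l<N. cnj (y k) * (c * T k l) * x l) =
      (\<Sum>k<N. if k = i then (\<Sum>l<N. if l = j then cnj (y i) * c * x j else 0) else 0)"
    proof (intro sum.cong refl)
      fix k
      show "(\<Sum>l<N. cnj (y k) * (c * T k l) * x l) =
          (if k = i then (\<Sum>l<N. if l = j then cnj (y i) * c * x j else 0) else 0)"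
      proof (cases "k = i")
        case True
        have "cnj (y i) * (c * T i l) * x l = (if l = j then cnj (y i) * c * x j else 0)" for l
          by (simp add: T_def)
        then show ?thesis using True by (simp only: if_True simp_thms)
      qed (simp add: T_def)
    qed
    then show ?thesis by simp
  qed
  have "mat_norm T \<le> ereal 1"
    unfolding mat_norm_le_iff
  proof (intro allI impI)
    fix N and x y :: "nat \<Rightarrow> complex"
    assume x: "(\<Sum>j<N. (cmod (x j))\<^sup>2) \<le> 1" and y: "(\<Sum>i<N. (cmod (y i))\<^sup>2) \<le> 1"
    have le: "cmod (z k) \<le> 1" if "(\<Sum>j<N. (cmod (z j))\<^sup>2) \<le> 1" "k < N" for z :: "nat \<Rightarrow> complex" and k
    proof -
      have "(cmod (z k))\<^sup>2 \<le> (\<Sum>j<N. (cmod (z j))\<^sup>2)"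
        by (rule member_le_sum) (use that in auto)
      then have "(cmod (z k))\<^sup>2 \<le> 1" using that by simp
      then show ?thesis by (simp add: power_le_one_iff abs_square_le_1)
    qed
    show "cmod (\<Sum>i<N. \<Sum>j<N. cnj (y i) * T i j * x j) \<le> 1"
      using form[of y 1 x N] le[OF x, of j] le[OF y, of i] by (auto simp: norm_mult mult_le_one)
  qed
  then have "mat_norm (\<lambda>k l. X k l * T k l) \<le> schur_norm X"
    by (intro schur_norm_ge) (simp add: one_ereal_def)
  moreover have "ereal (cmod (\<Sum>k<n. \<Sum>l<n. cnj (e i k) * (X k l * T k l) * e j l)) \<le>
      mat_norm (\<lambda>k l. X k l * T k l)"
  proof (rule mat_norm_ge_form)
    have "(cmod (e k l))\<^sup>2 = (if l = k then 1 else 0)" for k l by (simp add: e_def)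
    then show "(\<Sum>l<n. (cmod (e j l))\<^sup>2) \<le> 1" "(\<Sum>k<n. (cmod (e i k))\<^sup>2) \<le> 1" by simp_all
  qed
  moreover have "(\<Sum>k<n. \<Sum>l<n. cnj (e i k) * (X k l * T k l) * e j l) = X i j"
  proof -
    have "(\<Sum>k<n. \<Sum>l<n. cnj (e i k) * (X k l * T k l) * e j l) =
       (\<Sum>k<n. \<Sum>l<n. cnj (e i k) * (X i j * T k l) * e j l)"
      by (intro sum.cong refl) (auto simp: T_def)
    moreover have "i < n" "j < n" by (auto simp: n_def)
    ultimately show ?thesis by (simp only: form) (simp add: e_def)
  qed
  ultimately show ?thesis by simp
qed

section \<open>Splitting patterns of bounded density\<close>

text \<open>Read \<open>S e\<close> as the vertices to which \<open>e\<close> may be assigned, each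
  of capacity \<open>m\<close>. If both choices failed, there would be two violating sets; as the
  number of vertices met is submodular, their union, or their intersection without \<open>e\<close>,
  would violate the original condition.\<close>

lemma hall_condition_shrink:
  fixes S :: "'e \<Rightarrow> 'v set" and m :: nat
  assumes hall: "\<And>D. D \<subseteq> P \<Longrightarrow> finite D \<Longrightarrow> card D \<le> m * card (\<Union>(S ` D))"
    and fin: "\<And>e. finite (S e)" and e: "e \<in> P" "S e = {a, b}"
  shows "(\<forall>D\<subseteq>P. finite D \<longrightarrow> card D \<le> m * card (\<Union>((S(e := {a})) ` D))) \<or>
         (\<forall>D\<subseteq>P. finite D \<longrightarrow> card D \<le> m * card (\<Union>((S(e := {b})) ` D)))"
proof (rule ccontr)
  assume "\<not> ?thesis"
  then obtain D1 D2 where D1: "D1 \<subseteq> P" "finite D1" "card D1 > m * card (\<Union>((S(e := {a})) ` D1))"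
    and D2: "D2 \<subseteq> P" "finite D2" "card D2 > m * card (\<Union>((S(e := {b})) ` D2))"
    by (auto simp: not_le)
  have mem: "e \<in> D" if "D \<subseteq> P" "finite D" "card D > m * card (\<Union>((S(e := {c})) ` D))" for D c
  proof (rule ccontr)
    assume "e \<notin> D"
    then have "(S(e := {c})) ` D = S ` D" by auto
    then show False using hall[of D] that by simp
  qed
  \<comment> \<open>Only \<open>S e\<close> has changed, so every violation involves
    \<open>e\<close>.\<close>
  have eD: "e \<in> D1" "e \<in> D2" using mem D1 D2 by auto
  define E1 where "E1 = D1 - {e}"
  define E2 where "E2 = D2 - {e}"
  have D_eq: "D1 = insert e E1" "D2 = insert e E2" "e \<notin> E1" "e \<notin> E2"
    using eD by (auto simp: E1_def E2_def)
  have finE: "finite E1" "finite E2" using D1 D2 by (auto simp: E1_def E2_def)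
  define V1 where "V1 = insert a (\<Union>(S ` E1))"
  define V2 where "V2 = insert b (\<Union>(S ` E2))"
  have finV: "finite V1" "finite V2" using finE fin by (auto simp: V1_def V2_def)
  have "\<Union>((S(e := {a})) ` D1) = V1" "\<Union>((S(e := {b})) ` D2) = V2"
    using D_eq by (auto simp: V1_def V2_def)
  then have "m * card V1 \<le> card E1" "m * card V2 \<le> card E2"
    using D1 D2 D_eq finE by simp_all
  then have "m * card V1 + m * card V2 \<le> card E1 + card E2" by simp
  also have "\<dots> = card (E1 \<union> E2) + card (E1 \<inter> E2)" using finE by (rule card_Un_Int)
  \<comment> \<open>Strictness comes from returning \<open>e\<close> to the union only. This costs
    no vertex, since \<open>a\<close> and \<open>b\<close> both lie in
    \<open>V1 \<union> V2\<close>.\<close>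
  also have "\<dots> < card (insert e (E1 \<union> E2)) + card (E1 \<inter> E2)" using finE D_eq by simp
  also have "\<dots> \<le> m * card (V1 \<union> V2) + m * card (V1 \<inter> V2)"
  proof (rule add_mono)
    have "card (insert e (E1 \<union> E2)) \<le> m * card (\<Union>(S ` insert e (E1 \<union> E2)))"
      using D1 D2 D_eq finE by (intro hall) auto
    also have "\<Union>(S ` insert e (E1 \<union> E2)) = V1 \<union> V2" using e by (auto simp: V1_def V2_def)
    finally show "card (insert e (E1 \<union> E2)) \<le> m * card (V1 \<union> V2)" .
    have "card (E1 \<inter> E2) \<le> m * card (\<Union>(S ` (E1 \<inter> E2)))"
      using D1 D_eq finE by (intro hall) auto
    also have "\<dots> \<le> m * card (V1 \<inter> V2)"
      using finV by (intro mult_left_mono card_mono) (auto simp: V1_def V2_def)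
    finally show "card (E1 \<inter> E2) \<le> m * card (V1 \<inter> V2)" .
  qed
  also have "\<dots> = m * card V1 + m * card V2"
    using card_Un_Int[OF finV] by (simp add: distrib_left[symmetric])
  finally show False by simp
qed

text \<open>Clearing the denominator also admits \<open>R = C = {}\<close>, where the inequality is
  trivial.\<close>

lemma pattern_density_le_iff:
  "pattern_density P \<le> ereal (real k) \<longleftrightarrow>
    (\<forall>R C. finite R \<longrightarrow> finite C \<longrightarrow> card (P \<inter> (R \<times> C)) \<le> k * (card R + card C))"
proof -
  have "(real (card (P \<inter> (R \<times> C))) / (real (card R) + real (card C)) \<le> real k) =
      (card (P \<inter> (R \<times> C)) \<le> k * (card R + card C))"
    if "finite R" "finite C" "R \<noteq> {} \<or> C \<noteq> {}" for R C
  proof -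
    have "card R + card C > 0" using that by (auto simp: card_gt_0_iff)
    then have "(real (card (P \<inter> (R \<times> C))) / real (card R + card C) \<le> real k) =
        (real (card (P \<inter> (R \<times> C))) \<le> real (k * (card R + card C)))"
      by (subst pos_divide_le_eq) (auto simp del: of_nat_add)
    then show ?thesis unfolding of_nat_le_iff by simp
  qed
  then have "pattern_density P \<le> ereal (real k) \<longleftrightarrow>
      (\<forall>R C. finite R \<and> finite C \<and> (R \<noteq> {} \<or> C \<noteq> {}) \<longrightarrow> card (P \<inter> (R \<times> C)) \<le> k * (card R + card C))"
    unfolding pattern_density_def SUP_le_iff by auto
  moreover have "card (P \<inter> ({} \<times> {})) \<le> k * (card {} + card {})" by simp
  ultimately show ?thesis by metis
qed

text \<open>Elements of \<open>Q1\<close> are charged to their rows, those of \<open>Q2\<close> to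
  their columns.\<close>

lemma pattern_density_le_of_union:
  assumes "P = Q1 \<union> Q2" "row_bounded Q1 k" "col_bounded Q2 k"
  shows "pattern_density P \<le> ereal (real k)"
  unfolding pattern_density_le_iff
proof (intro allI impI)
  fix R C :: "nat set" assume fin: "finite R" "finite C"
  have "P \<inter> (R \<times> C) \<subseteq> (SIGMA i:R. {j. (i, j) \<in> Q1}) \<union> prod.swap ` (SIGMA j:C. {i. (i, j) \<in> Q2})"
    (is "_ \<subseteq> ?A \<union> prod.swap ` ?B")
    using assms by (force simp: image_iff)
  moreover have finAB: "finite ?A" "finite ?B"
    using fin assms by (auto simp: row_bounded_def col_bounded_def)
  ultimately have "card (P \<inter> (R \<times> C)) \<le> card (?A \<union> prod.swap ` ?B)" by (intro card_mono) auto
  also have "\<dots> \<le> card ?A + card (prod.swap ` ?B)" by (rule card_Un_le)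
  also have "\<dots> \<le> card ?A + card ?B" using finAB by (simp add: card_image_le)
  also have "card ?A = (\<Sum>i\<in>R. card {j. (i, j) \<in> Q1})"
    using fin assms by (subst card_SigmaI) (auto simp: row_bounded_def)
  also have "\<dots> \<le> of_nat (card R) * k"
    using assms by (intro sum_bounded_above) (auto simp: row_bounded_def)
  also have "card ?B = (\<Sum>j\<in>C. card {i. (i, j) \<in> Q2})"
    using fin assms by (subst card_SigmaI) (auto simp: col_bounded_def)
  also have "\<dots> \<le> of_nat (card C) * k"
    using assms by (intro sum_bounded_above) (auto simp: col_bounded_def)
  finally show "card (P \<inter> (R \<times> C)) \<le> k * (card R + card C)" by (simp add: algebra_simps)
qed

text \<open>An element of \<open>P\<close> is an edge between the vertices \<open>Inl\<close> of its
  row and \<open>Inr\<close> of its column, and the density bound becomes Hall's condition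
  \<open>H\<close> with capacity \<open>m\<close>.\<close>

lemma union_of_pattern_density_le:
  assumes "pattern_density P \<le> ereal (real m)"
  shows "\<exists>Q1 Q2. P = Q1 \<union> Q2 \<and> row_bounded Q1 m \<and> col_bounded Q2 m"
proof -
  define H where "H S \<longleftrightarrow> (\<forall>D\<subseteq>P. finite D \<longrightarrow> card D \<le> m * card (\<Union>(S ` D)))"
    for S :: "nat \<times> nat \<Rightarrow> (nat + nat) set"
  define full :: "nat \<times> nat \<Rightarrow> (nat + nat) set" where "full e = {Inl (fst e), Inr (snd e)}" for e
  have "H full"
    unfolding H_def
  proof (intro allI impI)
    fix D :: "(nat \<times> nat) set" assume D: "D \<subseteq> P" "finite D"
    have "card D \<le> card (P \<inter> (fst ` D \<times> snd ` D))"
    proof (rule card_mono)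
      show "D \<subseteq> P \<inter> (fst ` D \<times> snd ` D)" using D subset_fst_snd[of D] by blast
    qed (use D in blast)
    also have "\<dots> \<le> m * (card (fst ` D) + card (snd ` D))"
      using assms[unfolded pattern_density_le_iff] D(2) by (metis finite_imageI)
    also have "\<Union>(full ` D) = Inl ` fst ` D \<union> Inr ` snd ` D" by (auto simp: full_def)
    then have "card (fst ` D) + card (snd ` D) = card (\<Union>(full ` D))"
    proof -
      have "card (Inl ` fst ` D \<union> Inr ` snd ` D) = card (Inl ` fst ` D :: (nat + nat) set) + card (Inr ` snd ` D :: (nat + nat) set)"
        by (rule card_Un_disjoint) (use D in auto)
      then show ?thesis using \<open>\<Union>(full ` D) = _\<close> by (simp add: card_image)
    qed
    finally show "card D \<le> m * card (\<Union>(full ` D))" .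
  qed
  \<comment> \<open>Decide the edges one after the other; \<open>prod_decode\<close> enumerates them.\<close>
  let ?Q = "\<lambda>n S S'. (\<forall>e. e \<noteq> prod_decode n \<longrightarrow> S' e = S e) \<and> S' (prod_decode n) \<subseteq> S (prod_decode n) \<and>
       (prod_decode n \<in> P \<longrightarrow> card (S' (prod_decode n)) \<le> 1)"
  have "\<exists>S. \<forall>n. (H (S n) \<and> (\<forall>e. S n e \<subseteq> full e)) \<and> ?Q n (S n) (S (Suc n))"
  proof (rule dependent_nat_choice)
    show "\<exists>S. H S \<and> (\<forall>e. S e \<subseteq> full e)" using \<open>H full\<close> by blast
    fix S n assume S: "H S \<and> (\<forall>e. S e \<subseteq> full e)"
    define e where "e = prod_decode n"
    have "finite (full e)" for e by (simp add: full_def)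
    then have fin: "finite (S e)" for e using S by (meson finite_subset)
    show "\<exists>S'. (H S' \<and> (\<forall>e. S' e \<subseteq> full e)) \<and> ?Q n S S'"
    proof (cases "e \<in> P \<and> S e = full e")
      case True
      then have "S e = {Inl (fst e), Inr (snd e)}" by (simp add: full_def)
      then have "H (S(e := {Inl (fst e)})) \<or> H (S(e := {Inr (snd e)}))"
        unfolding H_def using S True fin by (intro hall_condition_shrink) (auto simp: H_def)
      then obtain c where "H (S(e := {c}))" "c \<in> full e" by (auto simp: full_def)
      then show ?thesis unfolding e_def[symmetric]
        by (intro exI[of _ "S(e := {c})"]) (use S True in simp)
    next
      case False
      have "card (S e) \<le> 1" if "e \<in> P"
      proof -
        have "S e \<subset> full e" using S False that by (metis psubsetI)
        then have "card (S e) < card (full e)" by (intro psubset_card_mono) (auto simp: full_def)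
        then show ?thesis by (simp add: full_def)
      qed
      then show ?thesis by (intro exI[of _ S]) (use S in \<open>auto simp: e_def\<close>)
    qed
  qed
  then obtain S where H: "\<And>n. H (S n)" and sub: "\<And>n e. S n e \<subseteq> full e"
    and Q: "\<And>n. ?Q n (S n) (S (Suc n))" by metis
  \<comment> \<open>Stage \<open>prod_encode e\<close> settles \<open>e\<close> and later stages
    leave it alone, so \<open>F\<close> is the pointwise limit of the stages.\<close>
  define F where "F e = S (Suc (prod_encode e)) e" for e
  have stab: "S n e = F e" if "n > prod_encode e" for n e
    using that
  proof (induction n)
    case (Suc n)
    show ?case
    proof (cases "n = prod_encode e")
      case False
      then have "n > prod_encode e" and "e \<noteq> prod_decode n" using Suc by auto
      then show ?thesis using Suc.IH Q[of n] by metis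
    qed (simp add: F_def)
  qed simp
  have HF: "H F"
    unfolding H_def
  proof (intro allI impI)
    fix D assume D: "D \<subseteq> P" "finite D"
    \<comment> \<open>At this stage all of \<open>D\<close> is settled; the inserted
      \<open>0\<close> covers empty \<open>D\<close>.\<close>
    define n where "n = Suc (Max (insert 0 (prod_encode ` D)))"
    have "S n e = F e" if "e \<in> D" for e
      using that D by (intro stab) (auto simp: n_def less_Suc_eq_le)
    then have "S n ` D = F ` D" by simp
    then show "card D \<le> m * card (\<Union>(F ` D))" using H[of n] D unfolding H_def by metis
  qed
  have card1: "card (F e) \<le> 1" if "e \<in> P" for e
    using Q[of "prod_encode e"] that by (simp add: F_def)
  have ne: "F e \<noteq> {}" if "e \<in> P" for e
    using HF[unfolded H_def, rule_format, of "{e}"] that by auto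
  \<comment> \<open>Elements assigned to \<open>v\<close> have no other option left, so together
    they meet one vertex and \<open>H F\<close> bounds every finite set of them by
    \<open>m\<close>.\<close>
  have load: "finite {e\<in>P. v \<in> F e} \<and> card {e\<in>P. v \<in> F e} \<le> m" for v
  proof -
    have "card D \<le> m" if D: "D \<subseteq> {e\<in>P. v \<in> F e}" "finite D" for D
    proof -
      have "F e = {v}" if "e \<in> D" for e
      proof -
        have "F e \<subseteq> full e" using sub by (simp add: F_def)
        then have "finite (F e)" by (rule finite_subset) (simp add: full_def)
        moreover have "v \<in> F e" "card (F e) \<le> 1" using card1[of e] D that by auto
        ultimately show ?thesis by (auto simp: card_le_Suc0_iff_eq)
      qed
      then have "\<Union>(F ` D) \<subseteq> {v}" by auto
      then have "card (\<Union>(F ` D)) \<le> 1" using card_mono[of "{v}"] by fastforce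
      moreover have "card D \<le> m * card (\<Union>(F ` D))" using HF D unfolding H_def by auto
      ultimately show ?thesis by (metis le_trans mult.right_neutral mult_le_mono2)
    qed
    then show ?thesis using finite_if_finite_subsets_card_bdd by blast
  qed
  define Q1 where "Q1 = {e\<in>P. Inl (fst e) \<in> F e}"
  define Q2 where "Q2 = {e\<in>P. Inr (snd e) \<in> F e}"
  have "P = Q1 \<union> Q2"
    using ne sub unfolding Q1_def Q2_def F_def full_def by blast
  moreover have "row_bounded Q1 m"
    unfolding row_bounded_def
  proof
    fix i
    have "inj_on (\<lambda>j. (i, j)) {j. (i, j) \<in> Q1}" by (simp add: inj_on_def)
    moreover have "(\<lambda>j. (i, j)) ` {j. (i, j) \<in> Q1} \<subseteq> {e\<in>P. Inl i \<in> F e}"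
      by (auto simp: Q1_def)
    ultimately show "finite {j. (i, j) \<in> Q1} \<and> card {j. (i, j) \<in> Q1} \<le> m"
      using load[of "Inl i"] by (meson card_inj_on_le inj_on_finite le_trans)
  qed
  moreover have "col_bounded Q2 m"
    unfolding col_bounded_def
  proof
    fix j
    have "inj_on (\<lambda>i. (i, j)) {i. (i, j) \<in> Q2}" by (simp add: inj_on_def)
    moreover have "(\<lambda>i. (i, j)) ` {i. (i, j) \<in> Q2} \<subseteq> {e\<in>P. Inr j \<in> F e}"
      by (auto simp: Q2_def)
    ultimately show "finite {i. (i, j) \<in> Q2} \<and> card {i. (i, j) \<in> Q2} \<le> m"
      using load[of "Inr j"] by (meson card_inj_on_le inj_on_finite le_trans)
  qed
  ultimately show ?thesis by blast
qed

section \<open>Signs of small cut norm\<close>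

text \<open>After taking logarithms both sides agree at \<open>0\<close>, and the derivatives
  satisfy \<open>tanh x \<le> x\<close>.\<close>

lemma cosh_le_exp_half_square:
  fixes t :: real assumes "t \<ge> 0"
  shows "cosh t \<le> exp (t\<^sup>2 / 2)"
proof -
  have tanh: "sinh s \<le> s * cosh s" if "s \<ge> 0" for s :: real
  proof -
    have "(\<lambda>s. s * cosh s - sinh s) 0 \<le> (\<lambda>s. s * cosh s - sinh s) s"
    proof (rule DERIV_nonneg_imp_nondecreasing[OF that])
      fix x :: real assume "0 \<le> x" "x \<le> s"
      then show "\<exists>y. ((\<lambda>s. s * cosh s - sinh s) has_real_derivative y) (at x) \<and> 0 \<le> y"
        by (intro exI[of _ "x * sinh x"]) (auto intro!: derivative_eq_intros)
    qed
    then show ?thesis by simp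
  qed
  have "(\<lambda>s. s\<^sup>2 / 2 - ln (cosh s)) 0 \<le> (\<lambda>s. s\<^sup>2 / 2 - ln (cosh s)) t"
  proof (rule DERIV_nonneg_imp_nondecreasing[OF assms])
    fix x :: real assume x: "0 \<le> x" "x \<le> t"
    have "((\<lambda>s. s\<^sup>2 / 2 - ln (cosh s)) has_real_derivative (x - sinh x / cosh x)) (at x)"
      by (auto intro!: derivative_eq_intros simp: cosh_real_pos)
    moreover have "0 \<le> x - sinh x / cosh x" using tanh[OF x(1)] by (simp add: cosh_real_pos field_simps)
    ultimately show "\<exists>y. ((\<lambda>s. s\<^sup>2 / 2 - ln (cosh s)) has_real_derivative y) (at x) \<and> 0 \<le> y" by blast
  qed
  then have "ln (cosh t) \<le> t\<^sup>2 / 2" by simp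
  then show ?thesis by (metis cosh_real_pos exp_le_cancel_iff exp_ln)
qed

text \<open>Averaging over the two signs of one element multiplies the total weight by
  \<open>cosh t\<close>, so one of the signs does no worse. The general weight \<open>w\<close>
  absorbs the factors already fixed in the induction.\<close>

lemma exists_signs_exp_moment:
  fixes t :: real
  assumes "finite D" and \<sigma>: "\<And>\<omega> e. \<omega> \<in> \<Omega> \<Longrightarrow> e \<in> D \<Longrightarrow> \<sigma> \<omega> e \<in> {-1, 1::real}"
    and w: "\<And>\<omega>. \<omega> \<in> \<Omega> \<Longrightarrow> 0 \<le> w \<omega>"
  shows "\<exists>A. (\<forall>e. A e \<in> {-1, 1::real}) \<and>
    (\<Sum>\<omega>\<in>\<Omega>. w \<omega> * exp (t * (\<Sum>e\<in>D. A e * \<sigma> \<omega> e))) \<le> cosh t ^ card D * sum w \<Omega>"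
  using assms
proof (induction D arbitrary: w rule: finite_induct)
  case empty
  show ?case by (intro exI[of _ "\<lambda>_. 1"]) simp
next
  case (insert e D)
  have "(\<Sum>\<omega>\<in>\<Omega>. w \<omega> * exp (t * (1 * \<sigma> \<omega> e))) + (\<Sum>\<omega>\<in>\<Omega>. w \<omega> * exp (t * (-1 * \<sigma> \<omega> e))) =
      (\<Sum>\<omega>\<in>\<Omega>. w \<omega> * (2 * cosh t))"
    unfolding sum.distrib[symmetric]
  proof (rule sum.cong[OF refl])
    fix \<omega> assume "\<omega> \<in> \<Omega>"
    then have "\<sigma> \<omega> e = -1 \<or> \<sigma> \<omega> e = 1" using insert.prems by auto
    then show "w \<omega> * exp (t * (1 * \<sigma> \<omega> e)) + w \<omega> * exp (t * (-1 * \<sigma> \<omega> e)) = w \<omega> * (2 * cosh t)"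
      by (auto simp: cosh_def algebra_simps)
  qed
  also have "\<dots> = cosh t * sum w \<Omega> + cosh t * sum w \<Omega>"
    by (simp add: sum_distrib_right[symmetric])
  finally have "(\<Sum>\<omega>\<in>\<Omega>. w \<omega> * exp (t * (1 * \<sigma> \<omega> e))) \<le> cosh t * sum w \<Omega> \<or>
      (\<Sum>\<omega>\<in>\<Omega>. w \<omega> * exp (t * (-1 * \<sigma> \<omega> e))) \<le> cosh t * sum w \<Omega>" by linarith
  then obtain s where s: "s \<in> {-1, 1::real}"
    "(\<Sum>\<omega>\<in>\<Omega>. w \<omega> * exp (t * (s * \<sigma> \<omega> e))) \<le> cosh t * sum w \<Omega>"
    by blast
  define w' where "w' \<omega> = w \<omega> * exp (t * (s * \<sigma> \<omega> e))" for \<omega>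
  obtain A where A: "\<And>e. A e \<in> {-1, 1::real}"
    "(\<Sum>\<omega>\<in>\<Omega>. w' \<omega> * exp (t * (\<Sum>e\<in>D. A e * \<sigma> \<omega> e))) \<le> cosh t ^ card D * sum w' \<Omega>"
    using insert.IH[of w'] insert.prems by (auto simp: w'_def)
  have "(\<Sum>f\<in>insert e D. (A(e := s)) f * \<sigma> \<omega> f) = s * \<sigma> \<omega> e + (\<Sum>f\<in>D. A f * \<sigma> \<omega> f)" for \<omega>
  proof -
    have "(\<Sum>f\<in>D. (A(e := s)) f * \<sigma> \<omega> f) = (\<Sum>f\<in>D. A f * \<sigma> \<omega> f)"
      using insert.hyps by (intro sum.cong) auto
    then show ?thesis using insert.hyps by simp
  qed
  then have "(\<Sum>\<omega>\<in>\<Omega>. w \<omega> * exp (t * (\<Sum>f\<in>insert e D. (A(e := s)) f * \<sigma> \<omega> f))) =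
      (\<Sum>\<omega>\<in>\<Omega>. w' \<omega> * exp (t * (\<Sum>e\<in>D. A e * \<sigma> \<omega> e)))"
    by (simp only: w'_def) (simp add: distrib_left exp_add mult.assoc)
  also note A(2)
  also have "cosh t ^ card D * sum w' \<Omega> \<le> cosh t ^ card D * (cosh t * sum w \<Omega>)"
    using s by (intro mult_left_mono) (auto simp: w'_def)
  finally have "(\<Sum>\<omega>\<in>\<Omega>. w \<omega> * exp (t * (\<Sum>f\<in>insert e D. (A(e := s)) f * \<sigma> \<omega> f))) \<le>
      cosh t ^ card (insert e D) * sum w \<Omega>"
    using insert.hyps by (simp add: mult_ac)
  moreover have "\<forall>f. (A(e := s)) f \<in> {-1, 1}" using A(1) s(1) by simp
  ultimately show ?case by (intro exI[of _ "A(e := s)"] conjI)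
qed

lemma sum_fibres:
  fixes h :: "'e \<Rightarrow> real"
  assumes "finite D"
  shows "(\<Sum>e\<in>D. h e * b (p e)) = (\<Sum>i\<in>p ` D. (\<Sum>e | e \<in> D \<and> p e = i. h e) * b i)"
proof -
  have "(\<Sum>e\<in>D. h e * b (p e)) = (\<Sum>i\<in>p ` D. \<Sum>e | e \<in> D \<and> p e = i. h e * b (p e))"
    using assms by (rule sum.image_gen)
  also have "\<dots> = (\<Sum>i\<in>p ` D. (\<Sum>e | e \<in> D \<and> p e = i. h e) * b i)"
    unfolding sum_distrib_right by (intro sum.cong) auto
  finally show ?thesis .
qed

text \<open>The sum is linear in each \<open>a i\<close>, so the sign of its coefficient
  \<open>g i\<close> is the best choice.\<close>

lemma sum_le_sum_signs:
  fixes h :: "'e \<Rightarrow> real" and p :: "'e \<Rightarrow> 'i"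
  assumes "finite D" and a: "\<And>i. \<bar>a i\<bar> \<le> 1"
  shows "\<exists>s. (\<forall>i. s i \<in> {-1, 1}) \<and> (\<Sum>e\<in>D. h e * a (p e)) \<le> (\<Sum>e\<in>D. h e * s (p e))"
proof -
  define g where "g i = (\<Sum>e | e \<in> D \<and> p e = i. h e)" for i
  have group: "(\<Sum>e\<in>D. h e * b (p e)) = (\<Sum>i\<in>p ` D. g i * b i)" for b
    unfolding g_def using assms(1) by (rule sum_fibres)
  define s where "s i = (if g i \<ge> 0 then 1 else -1 :: real)" for i
  have "g i * a i \<le> g i * s i" for i
    using a[of i] mult_left_mono[of "a i" 1 "g i"] mult_left_mono_neg[of "-1" "a i" "g i"]
    by (auto simp: s_def)
  then have "(\<Sum>e\<in>D. h e * a (p e)) \<le> (\<Sum>e\<in>D. h e * s (p e))"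
    unfolding group by (intro sum_mono)
  then show ?thesis by (intro exI[of _ s]) (auto simp: s_def)
qed

text \<open>A union bound over the \<open>2 ^ q\<close> pairs of sign vectors: each exponential is
  at most the whole exponential moment.\<close>

lemma exists_signs_cut_norm:
  fixes D :: "(nat \<times> nat) set"
  assumes D: "finite D" "D \<noteq> {}"
  defines "L \<equiv> sqrt (2 * ln 2 * real (card D) * real (card (fst ` D) + card (snd ` D)))"
  shows "\<exists>A. (\<forall>e. A e \<in> {-1, 1::real}) \<and>
    (\<forall>a b. (\<forall>i. \<bar>a i\<bar> \<le> 1) \<longrightarrow> (\<forall>j. \<bar>b j\<bar> \<le> 1) \<longrightarrow> (\<Sum>e\<in>D. A e * a (fst e) * b (snd e)) \<le> L)"
proof -
  define R where "R = fst ` D"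
  define C where "C = snd ` D"
  define q where "q = card R + card C"
  define N where "N = card D"
  have fin: "finite R" "finite C" using D by (auto simp: R_def C_def)
  have N: "N > 0" using D by (simp add: N_def card_gt_0_iff)
  have q: "q > 0" using D by (simp add: q_def R_def card_gt_0_iff)
  define \<Omega> where "\<Omega> = (R \<rightarrow>\<^sub>E {-1, 1::real}) \<times> (C \<rightarrow>\<^sub>E {-1, 1::real})"
  define \<sigma> where "\<sigma> \<omega> e = fst \<omega> (fst e) * snd \<omega> (snd e)"
    for \<omega> :: "(nat \<Rightarrow> real) \<times> (nat \<Rightarrow> real)" and e :: "nat \<times> nat"
  have fin\<Omega>: "finite \<Omega>" unfolding \<Omega>_def using fin by (intro finite_cartesian_product finite_PiE) auto
  have card\<Omega>: "card \<Omega> = 2 ^ q"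
    unfolding \<Omega>_def card_cartesian_product using fin by (simp add: card_PiE q_def power_add numeral_2_eq_2)
  \<comment> \<open>This \<open>t\<close> minimises \<open>(N * t^2 / 2 + q * ln 2) / t\<close>, and
    the minimum is \<open>L\<close>.\<close>
  define t where "t = sqrt (2 * ln 2 * real q / real N)"
  have t: "t > 0" using N q by (simp add: t_def)
  have t2: "t\<^sup>2 * real N = 2 * ln 2 * real q" using N by (simp add: t_def)
  have "\<sigma> \<omega> e \<in> {-1, 1}" if "\<omega> \<in> \<Omega>" "e \<in> D" for \<omega> e
  proof -
    have "fst \<omega> (fst e) \<in> {-1, 1}" "snd \<omega> (snd e) \<in> {-1, 1}"
      using that by (auto simp: \<Omega>_def R_def C_def mem_Times_iff intro: PiE_mem)
    then show ?thesis by (auto simp: \<sigma>_def)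
  qed
  from exists_signs_exp_moment[OF D(1), of \<Omega> \<sigma> "\<lambda>_. 1" t, OF this]
  obtain A where A: "\<And>e. A e \<in> {-1, 1::real}"
    and sum: "(\<Sum>\<omega>\<in>\<Omega>. exp (t * (\<Sum>e\<in>D. A e * \<sigma> \<omega> e))) \<le> cosh t ^ N * 2 ^ q"
    by (auto simp: card\<Omega> N_def)
  have \<Omega>: "(\<Sum>e\<in>D. A e * \<sigma> \<omega> e) \<le> L" if "\<omega> \<in> \<Omega>" for \<omega>
  proof -
    let ?Z = "\<Sum>e\<in>D. A e * \<sigma> \<omega> e"
    have "exp (t * ?Z) \<le> (\<Sum>\<omega>\<in>\<Omega>. exp (t * (\<Sum>e\<in>D. A e * \<sigma> \<omega> e)))"
      using fin\<Omega> that by (intro member_le_sum) auto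
    also note sum
    also have "cosh t ^ N * 2 ^ q \<le> exp (t\<^sup>2 / 2) ^ N * exp (ln 2) ^ q"
      using cosh_le_exp_half_square[of t] t by (intro mult_mono power_mono) auto
    also have "\<dots> = exp (real N * (t\<^sup>2 / 2) + real q * ln 2)"
      by (simp only: exp_add exp_of_nat_mult)
    finally have "t * ?Z \<le> real N * (t\<^sup>2 / 2) + real q * ln 2" by simp
    also have "\<dots> = 2 * ln 2 * real q" using t2 by (simp add: field_simps)
    also have "\<dots> = t * L"
    proof -
      have "t * L = sqrt ((2 * ln 2 * real q / real N) * (2 * ln 2 * real N * real q))"
        by (simp only: t_def L_def real_sqrt_mult N_def q_def R_def C_def)
      also have "(2 * ln 2 * real q / real N) * (2 * ln 2 * real N * real q) = (2 * ln 2 * real q)\<^sup>2"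
        using N by (simp add: power2_eq_square)
      finally show ?thesis by simp
    qed
    finally show ?thesis using t by simp
  qed
  have "(\<Sum>e\<in>D. A e * a (fst e) * b (snd e)) \<le> L" if a: "\<forall>i. \<bar>a i\<bar> \<le> 1" and b: "\<forall>j. \<bar>b j\<bar> \<le> 1" for a b
  proof -
    \<comment> \<open>Bounded coefficients reduce to signs one side at a time: \<open>a\<close> with
      \<open>b\<close> fixed, then \<open>b\<close>.\<close>
    obtain s where s: "\<forall>i. s i \<in> {-1, 1::real}"
      "(\<Sum>e\<in>D. (A e * b (snd e)) * a (fst e)) \<le> (\<Sum>e\<in>D. (A e * b (snd e)) * s (fst e))"
      using sum_le_sum_signs[OF D(1), of a "\<lambda>e. A e * b (snd e)" fst] a by auto
    obtain r where r: "\<forall>i. r i \<in> {-1, 1::real}"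
      "(\<Sum>e\<in>D. (A e * s (fst e)) * b (snd e)) \<le> (\<Sum>e\<in>D. (A e * s (fst e)) * r (snd e))"
      using sum_le_sum_signs[OF D(1), of b "\<lambda>e. A e * s (fst e)" snd] b by auto
    define \<omega> where "\<omega> = (restrict s R, restrict r C)"
    have "\<omega> \<in> \<Omega>" unfolding \<Omega>_def \<omega>_def using s(1) r(1) by (auto simp: PiE_iff)
    have "(\<Sum>e\<in>D. A e * a (fst e) * b (snd e)) \<le> (\<Sum>e\<in>D. (A e * s (fst e)) * r (snd e))"
      using s(2) r(2) by (simp add: mult_ac)
    also have "\<dots> = (\<Sum>e\<in>D. A e * \<sigma> \<omega> e)"
      by (intro sum.cong) (auto simp: \<sigma>_def \<omega>_def R_def C_def rev_image_eqI)
    also have "\<dots> \<le> L" by (rule \<Omega>) fact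
    finally show ?thesis .
  qed
  then show ?thesis using A by blast
qed

section \<open>Kernels of unit vectors and Grothendieck's inequality\<close>

text \<open>The dimension is left free: \<open>K\<close> may be any finite set, so tensor products
  and additional coordinates stay in the class.\<close>

definition unit_kernels :: "(nat \<times> nat \<Rightarrow> real) set" where
  "unit_kernels = {\<rho>. \<exists>(K::nat set) u v. finite K \<and> (\<forall>i. (\<Sum>k\<in>K. (u i k)\<^sup>2) = 1) \<and>
     (\<forall>j. (\<Sum>k\<in>K. (v j k)\<^sup>2) = 1) \<and> \<rho> = (\<lambda>(i, j). \<Sum>k\<in>K. u i k * v j k)}"

lemma unit_kernelsI:
  fixes K :: "nat set" and u v :: "nat \<Rightarrow> nat \<Rightarrow> real"
  assumes "finite K" "\<And>i. (\<Sum>k\<in>K. (u i k)\<^sup>2) = 1" "\<And>j. (\<Sum>k\<in>K. (v j k)\<^sup>2) = 1"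
    "\<And>i j. \<rho> (i, j) = (\<Sum>k\<in>K. u i k * v j k)"
  shows "\<rho> \<in> unit_kernels"
  unfolding unit_kernels_def using assms by (intro CollectI exI[of _ K] exI[of _ u] exI[of _ v]) auto

lemma unit_kernelsE:
  assumes "\<rho> \<in> unit_kernels"
  obtains K u v where "finite (K::nat set)" "\<And>i. (\<Sum>k\<in>K. (u i k)\<^sup>2) = 1" "\<And>j. (\<Sum>k\<in>K. (v j k)\<^sup>2) = 1"
    "\<And>i j. \<rho> (i, j) = (\<Sum>k\<in>K. u i k * v j k)"
  using assms unfolding unit_kernels_def by auto

lemma unit_kernels_nonempty: "unit_kernels \<noteq> {}"
  using unit_kernelsI[of "{0}" "\<lambda>_ _. 1" "\<lambda>_ _. 1" "\<lambda>_. 1"] by auto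

lemma unit_kernels_abs_le_1:
  assumes "\<rho> \<in> unit_kernels" shows "\<bar>\<rho> e\<bar> \<le> 1"
proof -
  obtain K u v where "finite (K::nat set)" and u: "\<And>i. (\<Sum>k\<in>K. (u i k)\<^sup>2) = 1" and v: "\<And>j. (\<Sum>k\<in>K. (v j k)\<^sup>2) = 1"
    and \<rho>: "\<And>i j. \<rho> (i, j) = (\<Sum>k\<in>K. u i k * v j k)" using assms by (rule unit_kernelsE) blast
  have "(\<rho> (fst e, snd e))\<^sup>2 \<le> 1"
    unfolding \<rho> using Cauchy_Schwarz_ineq_sum[of "u (fst e)" "v (snd e)" K] u v by simp
  then show ?thesis by (simp add: abs_square_le_1)
qed

lemma unit_kernels_uminus:
  assumes "\<rho> \<in> unit_kernels" shows "(\<lambda>e. - \<rho> e) \<in> unit_kernels"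
proof -
  obtain K u v where "finite (K::nat set)" "\<And>i. (\<Sum>k\<in>K. (u i k)\<^sup>2) = 1" "\<And>j. (\<Sum>k\<in>K. (v j k)\<^sup>2) = 1"
    "\<And>i j. \<rho> (i, j) = (\<Sum>k\<in>K. u i k * v j k)" using assms by (rule unit_kernelsE) blast
  then show ?thesis by (intro unit_kernelsI[of K "\<lambda>i k. - u i k" v]) (auto simp: sum_negf)
qed

text \<open>Inner products of tensor products multiply; \<open>prod_encode\<close> turns pairs of
  coordinates into natural numbers.\<close>

lemma unit_kernels_mult:
  assumes "\<rho> \<in> unit_kernels" "\<rho>' \<in> unit_kernels" shows "(\<lambda>e. \<rho> e * \<rho>' e) \<in> unit_kernels"
proof -
  obtain K u v where K: "finite (K::nat set)" and u: "\<And>i. (\<Sum>k\<in>K. (u i k)\<^sup>2) = 1" and v: "\<And>j. (\<Sum>k\<in>K. (v j k)\<^sup>2) = 1"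
    and \<rho>: "\<And>i j. \<rho> (i, j) = (\<Sum>k\<in>K. u i k * v j k)" using assms(1) by (rule unit_kernelsE) blast
  obtain K' u' v' where K': "finite (K'::nat set)" and u': "\<And>i. (\<Sum>k\<in>K'. (u' i k)\<^sup>2) = 1" and v': "\<And>j. (\<Sum>k\<in>K'. (v' j k)\<^sup>2) = 1"
    and \<rho>': "\<And>i j. \<rho>' (i, j) = (\<Sum>k\<in>K'. u' i k * v' j k)" using assms(2) by (rule unit_kernelsE) blast
  define T where "T f f' k = (case prod_decode k of (l, l') \<Rightarrow> f l * f' l')"
    for f f' :: "nat \<Rightarrow> real" and k
  have tensor: "(\<Sum>k\<in>prod_encode ` (K \<times> K'). T f f' k * T g g' k) =
      (\<Sum>k\<in>K. f k * g k) * (\<Sum>k\<in>K'. f' k * g' k)" for f f' g g'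
  proof -
    have "(\<Sum>k\<in>prod_encode ` (K \<times> K'). T f f' k * T g g' k) =
        (\<Sum>p\<in>K \<times> K'. (f (fst p) * g (fst p)) * (f' (snd p) * g' (snd p)))"
      by (subst sum.reindex) (auto simp: inj_prod_encode T_def split_def mult_ac)
    also have "\<dots> = (\<Sum>k\<in>K. f k * g k) * (\<Sum>k\<in>K'. f' k * g' k)"
      by (simp add: sum_product sum.cartesian_product split_def)
    finally show ?thesis .
  qed
  show ?thesis
    by (rule unit_kernelsI[of "prod_encode ` (K \<times> K')" "\<lambda>i. T (u i) (u' i)" "\<lambda>j. T (v j) (v' j)"])
       (use K K' u u' v v' \<rho> \<rho>' in \<open>auto simp: power2_eq_square tensor\<close>)
qed

lemma unit_kernels_power:
  assumes "\<rho> \<in> unit_kernels" "n > 0" shows "(\<lambda>e. \<rho> e ^ n) \<in> unit_kernels"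
  using assms(2)
proof (induction n rule: nat_induct_non_zero)
  case (Suc n)
  then show ?case using unit_kernels_mult[OF assms(1) Suc.IH] by simp
qed (use assms in simp)

text \<open>A fresh coordinate carries \<open>sqrt \<epsilon> * a i\<close> and
  \<open>sqrt \<epsilon> * b j\<close>; then the vectors are normalised.\<close>

lemma unit_kernels_perturb:
  assumes "\<rho> \<in> unit_kernels" "\<epsilon> \<ge> 0"
  shows "(\<lambda>e. (\<rho> e + \<epsilon> * (a (fst e) * b (snd e))) / (sqrt (1 + \<epsilon> * (a (fst e))\<^sup>2) * sqrt (1 + \<epsilon> * (b (snd e))\<^sup>2))) \<in> unit_kernels"
proof -
  obtain K u v where K: "finite (K::nat set)" and u: "\<And>i. (\<Sum>k\<in>K. (u i k)\<^sup>2) = 1" and v: "\<And>j. (\<Sum>k\<in>K. (v j k)\<^sup>2) = 1"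
    and \<rho>: "\<And>i j. \<rho> (i, j) = (\<Sum>k\<in>K. u i k * v j k)" using assms(1) by (rule unit_kernelsE) blast
  obtain l where l: "l \<notin> K" using ex_new_if_finite[OF infinite_UNIV_nat K] by blast
  define ext where "ext f c k = (if k = l then sqrt \<epsilon> * c else f k) / sqrt (1 + \<epsilon> * c\<^sup>2)"
    for f :: "nat \<Rightarrow> real" and c k
  have pos: "1 + \<epsilon> * c\<^sup>2 > 0" for c :: real using assms(2) by (simp add: add_pos_nonneg)
  have ext: "(\<Sum>k\<in>insert l K. ext f c k * ext g d k) =
      ((\<Sum>k\<in>K. f k * g k) + \<epsilon> * (c * d)) / (sqrt (1 + \<epsilon> * c\<^sup>2) * sqrt (1 + \<epsilon> * d\<^sup>2))" for f c g d
  proof -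
    have "(\<Sum>k\<in>K. ext f c k * ext g d k) = (\<Sum>k\<in>K. f k * g k / (sqrt (1 + \<epsilon> * c\<^sup>2) * sqrt (1 + \<epsilon> * d\<^sup>2)))"
      by (intro sum.cong) (use l in \<open>auto simp: ext_def\<close>)
    moreover have "ext f c l * ext g d l = \<epsilon> * (c * d) / (sqrt (1 + \<epsilon> * c\<^sup>2) * sqrt (1 + \<epsilon> * d\<^sup>2))"
      using assms(2) by (simp add: ext_def mult_ac flip: power2_eq_square)
    ultimately show ?thesis using K l by (simp add: sum_divide_distrib add_divide_distrib)
  qed
  have ext1: "(\<Sum>k\<in>insert l K. (ext f c k)\<^sup>2) = 1" if "(\<Sum>k\<in>K. (f k)\<^sup>2) = 1" for f c
    using ext[of f c f c] that pos[of c] by (simp add: power2_eq_square)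
  show ?thesis
    by (rule unit_kernelsI[of "insert l K" "\<lambda>i. ext (u i) (a i)" "\<lambda>j. ext (v j) (b j)"])
       (use K u v \<rho> in \<open>auto simp: ext1 ext simp del: sum.insert\<close>)
qed

section \<open>Rounding kernels by sines of Gaussians\<close>

text \<open>The bracket is the mean, over independent signs \<open>r k\<close>, of the product of
  the sines of \<open>\<alpha> i + (\<Sum>k\<in>E. r k * c i k)\<close> and
  \<open>\<beta> j + (\<Sum>k\<in>E. r k * d j k)\<close>. The phases are arbitrary for the sake of
  the induction.\<close>

lemma sum_cos_products_le:
  fixes A :: "nat \<times> nat \<Rightarrow> real"
  assumes L: "\<And>a b. (\<And>i. \<bar>a i\<bar> \<le> 1) \<Longrightarrow> (\<And>j. \<bar>b j\<bar> \<le> 1) \<Longrightarrow> (\<Sum>e\<in>D. A e * a (fst e) * b (snd e)) \<le> L"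
    and "finite E"
  shows "(\<Sum>e\<in>D. A e * ((cos (\<alpha> (fst e) - \<beta> (snd e)) * (\<Prod>k\<in>E. cos (c (fst e) k - d (snd e) k)) -
      cos (\<alpha> (fst e) + \<beta> (snd e)) * (\<Prod>k\<in>E. cos (c (fst e) k + d (snd e) k))) / 2)) \<le> L"
  using assms(2)
proof (induction E arbitrary: \<alpha> \<beta> rule: finite_induct)
  case empty
  have "(\<Sum>e\<in>D. A e * ((cos (\<alpha> (fst e) - \<beta> (snd e)) - cos (\<alpha> (fst e) + \<beta> (snd e))) / 2)) =
      (\<Sum>e\<in>D. A e * sin (\<alpha> (fst e)) * sin (\<beta> (snd e)))"
    by (intro sum.cong) (auto simp: cos_diff cos_add)
  also have "\<dots> \<le> L" by (intro L) auto
  finally show ?case by simp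
next
  case (insert k E)
  \<comment> \<open>Average the bound over the two phase shifts by \<open>\<plusminus>c\<^sub>k\<close>, \<open>\<plusminus>d\<^sub>k\<close>.\<close>
  let ?f = "\<lambda>\<alpha> \<beta> e. A e * ((cos (\<alpha> (fst e) - \<beta> (snd e)) * (\<Prod>k\<in>E. cos (c (fst e) k - d (snd e) k)) -
      cos (\<alpha> (fst e) + \<beta> (snd e)) * (\<Prod>k\<in>E. cos (c (fst e) k + d (snd e) k))) / 2)"
  have "A e * ((cos (\<alpha> (fst e) - \<beta> (snd e)) * (\<Prod>k\<in>insert k E. cos (c (fst e) k - d (snd e) k)) -
      cos (\<alpha> (fst e) + \<beta> (snd e)) * (\<Prod>k\<in>insert k E. cos (c (fst e) k + d (snd e) k))) / 2) =
      (?f (\<lambda>i. \<alpha> i + c i k) (\<lambda>j. \<beta> j + d j k) e + ?f (\<lambda>i. \<alpha> i - c i k) (\<lambda>j. \<beta> j - d j k) e) / 2" for e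
  proof -
    define x where "x = \<alpha> (fst e) - \<beta> (snd e)"
    define y where "y = \<alpha> (fst e) + \<beta> (snd e)"
    define x' where "x' = c (fst e) k - d (snd e) k"
    define y' where "y' = c (fst e) k + d (snd e) k"
    have shift: "\<alpha> (fst e) + c (fst e) k - (\<beta> (snd e) + d (snd e) k) = x + x'"
      "\<alpha> (fst e) - c (fst e) k - (\<beta> (snd e) - d (snd e) k) = x - x'"
      "\<alpha> (fst e) + c (fst e) k + (\<beta> (snd e) + d (snd e) k) = y + y'"
      "\<alpha> (fst e) - c (fst e) k + (\<beta> (snd e) - d (snd e) k) = y - y'"
      by (simp_all add: x_def x'_def y_def y'_def)
    show ?thesis
      unfolding prod.insert[OF insert.hyps] shift
      unfolding x_def[symmetric] y_def[symmetric] x'_def[symmetric] y'_def[symmetric] cos_add cos_diff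
      by (simp add: field_simps)
  qed
  then have "(\<Sum>e\<in>D. A e * ((cos (\<alpha> (fst e) - \<beta> (snd e)) * (\<Prod>k\<in>insert k E. cos (c (fst e) k - d (snd e) k)) -
      cos (\<alpha> (fst e) + \<beta> (snd e)) * (\<Prod>k\<in>insert k E. cos (c (fst e) k + d (snd e) k))) / 2)) =
      ((\<Sum>e\<in>D. ?f (\<lambda>i. \<alpha> i + c i k) (\<lambda>j. \<beta> j + d j k) e) + (\<Sum>e\<in>D. ?f (\<lambda>i. \<alpha> i - c i k) (\<lambda>j. \<beta> j - d j k) e)) / 2"
    by (simp only: sum.distrib sum_divide_distrib[symmetric])
  also have "\<dots> \<le> (L + L) / 2"
    by (intro divide_right_mono add_mono insert.IH) auto
  finally show ?case by simp
qed

text \<open>The central limit theorem for characteristic functions: \<open>cos\<close> belongs to a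
  fair sign, the limit to a standard Gaussian.\<close>

lemma tendsto_cos_power_exp: "(\<lambda>n. cos (x / sqrt (real n)) ^ n) \<longlonglongrightarrow> exp (- x\<^sup>2 / 2)"
  unfolding power2_eq_square by real_asymp

text \<open>For Gaussians of variance \<open>\<tau>\<close> and covariance
  \<open>\<tau> * \<rho>\<close>, the mean product of sines is
  \<open>exp (- \<tau>) * sinh (\<tau> * \<rho>)\<close>. Normalised sums of \<open>n\<close> signs
  replace the Gaussians, so a limit replaces integration.\<close>

lemma sum_sinh_le:
  fixes A :: "nat \<times> nat \<Rightarrow> real"
  assumes L: "\<And>a b. (\<And>i. \<bar>a i\<bar> \<le> 1) \<Longrightarrow> (\<And>j. \<bar>b j\<bar> \<le> 1) \<Longrightarrow> (\<Sum>e\<in>D. A e * a (fst e) * b (snd e)) \<le> L"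
    and "\<rho> \<in> unit_kernels" "\<tau> \<ge> 0"
  shows "(\<Sum>e\<in>D. A e * sinh (\<tau> * \<rho> e)) \<le> exp \<tau> * L"
proof -
  obtain K u v where K: "finite (K::nat set)" and u: "\<And>i. (\<Sum>k\<in>K. (u i k)\<^sup>2) = 1" and v: "\<And>j. (\<Sum>k\<in>K. (v j k)\<^sup>2) = 1"
    and \<rho>: "\<And>i j. \<rho> (i, j) = (\<Sum>k\<in>K. u i k * v j k)" using assms(2) by (rule unit_kernelsE) blast
  define f where "f n s i j = (\<Prod>k\<in>K. cos (sqrt \<tau> * (u i k + s * v j k) / sqrt (real n)) ^ n)"
    for n :: nat and s :: real and i j
  have lim: "(\<lambda>n. f n s i j) \<longlonglongrightarrow> exp (- \<tau> - s * (\<tau> * \<rho> (i, j)))" if "s\<^sup>2 = 1" for s i j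
  proof -
    have "(\<lambda>n. f n s i j) \<longlonglongrightarrow> (\<Prod>k\<in>K. exp (- (sqrt \<tau> * (u i k + s * v j k))\<^sup>2 / 2))"
      unfolding f_def by (intro tendsto_prod tendsto_cos_power_exp)
    also have "(\<Prod>k\<in>K. exp (- (sqrt \<tau> * (u i k + s * v j k))\<^sup>2 / 2)) =
        exp (\<Sum>k\<in>K. - (sqrt \<tau> * (u i k + s * v j k))\<^sup>2 / 2)"
      using K by (simp add: exp_sum)
    also have "(\<Sum>k\<in>K. - (sqrt \<tau> * (u i k + s * v j k))\<^sup>2 / 2) =
        (\<Sum>k\<in>K. - (\<tau> / 2) * (u i k)\<^sup>2 - (\<tau> / 2) * (v j k)\<^sup>2 - s * \<tau> * (u i k * v j k))"
    proof (intro sum.cong refl)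
      fix k
      have "(sqrt \<tau> * (u i k + s * v j k))\<^sup>2 = \<tau> * ((u i k)\<^sup>2 + s\<^sup>2 * (v j k)\<^sup>2 + 2 * s * (u i k * v j k))"
        using assms(3) by (simp add: power_mult_distrib power2_sum)
      then show "- (sqrt \<tau> * (u i k + s * v j k))\<^sup>2 / 2 =
          - (\<tau> / 2) * (u i k)\<^sup>2 - (\<tau> / 2) * (v j k)\<^sup>2 - s * \<tau> * (u i k * v j k)"
        unfolding that by (simp add: field_simps)
    qed
    also have "\<dots> = - \<tau> - s * (\<tau> * \<rho> (i, j))"
      by (simp only: sum_subtractf sum_distrib_left[symmetric] u v \<rho>)
    finally show ?thesis .
  qed
  have bound: "(\<Sum>e\<in>D. A e * ((f n (-1) (fst e) (snd e) - f n 1 (fst e) (snd e)) / 2)) \<le> L" for n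
  proof -
    \<comment> \<open>Coordinate \<open>k\<close> is split among \<open>n\<close> signs, indexed by
      the pairs \<open>(k, l)\<close> with \<open>l < n\<close>.\<close>
    define c where "c i p = sqrt \<tau> * u i (fst p) / sqrt (real n)" for i and p :: "nat \<times> nat"
    define d where "d j p = sqrt \<tau> * v j (fst p) / sqrt (real n)" for j and p :: "nat \<times> nat"
    have f1: "f n 1 i j = (\<Prod>p\<in>K \<times> {..<n}. cos (c i p + d j p))" for i j
      unfolding prod.cartesian_product[symmetric, where g="\<lambda>k l. cos (c i (k, l) + d j (k, l))", simplified]
      by (simp add: f_def c_def d_def add_divide_distrib distrib_left)
    have f2: "f n (-1) i j = (\<Prod>p\<in>K \<times> {..<n}. cos (c i p - d j p))" for i j
      unfolding prod.cartesian_product[symmetric, where g="\<lambda>k l. cos (c i (k, l) - d j (k, l))", simplified]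
      by (simp add: f_def c_def d_def diff_divide_distrib right_diff_distrib)
    have "(\<Sum>e\<in>D. A e * ((cos (0 - 0) * f n (-1) (fst e) (snd e) - cos (0 + 0) * f n 1 (fst e) (snd e)) / 2)) \<le> L"
      unfolding f1 f2 by (rule sum_cos_products_le[OF L, where \<alpha>="\<lambda>_. 0" and \<beta>="\<lambda>_. 0"]) (use K in auto)
    then show ?thesis by simp
  qed
  have "(\<Sum>e\<in>D. A e * ((exp (- \<tau> - (-1) * (\<tau> * \<rho> e)) - exp (- \<tau> - 1 * (\<tau> * \<rho> e))) / 2)) \<le> L"
  proof (rule LIMSEQ_le_const2)
    show "(\<lambda>n. \<Sum>e\<in>D. A e * ((f n (-1) (fst e) (snd e) - f n 1 (fst e) (snd e)) / 2)) \<longlonglongrightarrow>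
        (\<Sum>e\<in>D. A e * ((exp (- \<tau> - (-1) * (\<tau> * \<rho> e)) - exp (- \<tau> - 1 * (\<tau> * \<rho> e))) / 2))"
      using lim[of "-1" "fst _" "snd _"] lim[of 1 "fst _" "snd _"]
      by (intro tendsto_sum tendsto_intros) auto
  qed (use bound in blast)
  also have "(\<Sum>e\<in>D. A e * ((exp (- \<tau> - (-1) * (\<tau> * \<rho> e)) - exp (- \<tau> - 1 * (\<tau> * \<rho> e))) / 2)) =
      exp (- \<tau>) * (\<Sum>e\<in>D. A e * sinh (\<tau> * \<rho> e))"
    unfolding sum_distrib_left
    by (intro sum.cong) (auto simp: sinh_def exp_diff exp_add exp_minus field_simps)
  finally have "exp \<tau> * (exp (- \<tau>) * (\<Sum>e\<in>D. A e * sinh (\<tau> * \<rho> e))) \<le> exp \<tau> * L"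
    by (intro mult_left_mono) auto
  then show ?thesis by (simp add: mult.assoc[symmetric] exp_minus)
qed

section \<open>Maximal kernels and factorisation\<close>

text \<open>Tychonoff's theorem for the cube of functions with values in
  \<open>{-1..1}\<close>.\<close>

lemma compact_closure_unit_kernels: "compact (closure unit_kernels)"
proof -
  have "compactin (product_topology (\<lambda>_. euclidean) UNIV) (PiE UNIV (\<lambda>_::nat \<times> nat. {-1..1::real}))"
    by (subst compactin_PiE) auto
  then have "compact (PiE UNIV (\<lambda>_::nat \<times> nat. {-1..1::real}))"
    by (simp add: euclidean_product_topology)
  moreover have "unit_kernels \<subseteq> PiE UNIV (\<lambda>_. {-1..1})"
    using unit_kernels_abs_le_1 by (fastforce simp: abs_le_iff)
  ultimately show ?thesis
    by (metis closed_closure closure_minimal compact_Int_closed compact_imp_closed inf.absorb_iff2)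
qed

lemma continuous_on_sum_kernel:
  "continuous_on S (\<lambda>\<rho>::nat \<times> nat \<Rightarrow> real. \<Sum>e\<in>D. A e * \<rho> e)"
  by (intro continuous_intros continuous_on_subset[OF continuous_on_product_coordinates subset_UNIV])

text \<open>In the sinh series the linear term is the wanted sum. For odd \<open>n\<close> the
  negated power of \<open>\<rho>\<close> is again a kernel, so each higher term costs at most
  \<open>F\<close> times its coefficient.\<close>

lemma sum_kernel_le_sinh:
  fixes A :: "nat \<times> nat \<Rightarrow> real"
  assumes F: "\<And>\<rho>. \<rho> \<in> unit_kernels \<Longrightarrow> (\<Sum>e\<in>D. A e * \<rho> e) \<le> F"
    and \<rho>: "\<rho> \<in> unit_kernels" and \<tau>: "\<tau> \<ge> 0"
  shows "\<tau> * (\<Sum>e\<in>D. A e * \<rho> e) \<le> (\<Sum>e\<in>D. A e * sinh (\<tau> * \<rho> e)) + F * (sinh \<tau> - \<tau>)"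
proof -
  define c where "c n = (if even n then 0 else \<tau> ^ n /\<^sub>R fact n)" for n
  have c: "c n \<ge> 0" for n using \<tau> by (simp add: c_def)
  have "(\<lambda>n. (\<Sum>e\<in>D. A e * (if even n then 0 else (\<tau> * \<rho> e) ^ n /\<^sub>R fact n)) +
      F * (if even n then 0 else \<tau> ^ n /\<^sub>R fact n)) sums
      ((\<Sum>e\<in>D. A e * sinh (\<tau> * \<rho> e)) + F * sinh \<tau>)"
    by (intro sums_add sums_sum sums_mult sinh_converges)
  also have "(\<lambda>n. (\<Sum>e\<in>D. A e * (if even n then 0 else (\<tau> * \<rho> e) ^ n /\<^sub>R fact n)) +
      F * (if even n then 0 else \<tau> ^ n /\<^sub>R fact n)) =
      (\<lambda>n. c n * ((\<Sum>e\<in>D. A e * \<rho> e ^ n) + F))"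
    by (rule ext) (simp add: c_def distrib_left sum_distrib_left power_mult_distrib mult_ac)
  finally have sums: "(\<lambda>n. c n * ((\<Sum>e\<in>D. A e * \<rho> e ^ n) + F)) sums
      ((\<Sum>e\<in>D. A e * sinh (\<tau> * \<rho> e)) + F * sinh \<tau>)" .
  have nonneg: "c n * ((\<Sum>e\<in>D. A e * \<rho> e ^ n) + F) \<ge> 0" for n
  proof (cases "even n")
    case False
    then have "n > 0" by (auto intro: Nat.gr0I)
    from F[OF unit_kernels_uminus[OF unit_kernels_power[OF \<rho> this]]]
    have "(\<Sum>e\<in>D. A e * \<rho> e ^ n) + F \<ge> 0" by (simp add: sum_negf)
    then show ?thesis using c by simp
  qed (simp add: c_def)
  have "(\<Sum>n\<in>{1}. c n * ((\<Sum>e\<in>D. A e * \<rho> e ^ n) + F)) \<le> (\<Sum>n. c n * ((\<Sum>e\<in>D. A e * \<rho> e ^ n) + F))"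
    using sums nonneg by (intro sum_le_suminf) (auto simp: sums_iff)
  also have "\<dots> = (\<Sum>e\<in>D. A e * sinh (\<tau> * \<rho> e)) + F * sinh \<tau>" using sums by (simp add: sums_iff)
  finally show ?thesis by (simp add: c_def algebra_simps)
qed

text \<open>The first-order change of an entry in \<open>unit_kernels_perturb\<close>, with
  \<open>p\<close> and \<open>q\<close> the squares and \<open>c\<close> the product of the added
  values.\<close>

lemma deriv_normalised_perturbation:
  fixes r c p q :: real
  shows "((\<lambda>\<epsilon>. (r + \<epsilon> * c) / (sqrt (1 + \<epsilon> * p) * sqrt (1 + \<epsilon> * q))) has_real_derivative
    (c - r * ((p + q) / 2))) (at 0)"
  by (auto intro!: derivative_eq_intros simp: field_simps)

text \<open>The weights are \<open>A e * \<rho> e\<close> for a maximiser \<open>\<rho>\<close> in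
  the closure. Their total obeys Grothendieck's inequality, and the quadratic bound is first-order
  optimality of \<open>\<rho>\<close>.\<close>

lemma grothendieck_factorisation:
  fixes A :: "nat \<times> nat \<Rightarrow> real"
  assumes L: "\<And>a b. (\<And>i. \<bar>a i\<bar> \<le> 1) \<Longrightarrow> (\<And>j. \<bar>b j\<bar> \<le> 1) \<Longrightarrow> (\<Sum>e\<in>D. A e * a (fst e) * b (snd e)) \<le> L"
    and \<tau>: "\<tau> \<ge> 0"
  obtains w where "(\<Sum>e\<in>D. w e) * (2 * \<tau> - sinh \<tau>) \<le> exp \<tau> * L"
    "\<And>a b. (\<Sum>e\<in>D. A e * a (fst e) * b (snd e)) \<le> (\<Sum>e\<in>D. w e * (((a (fst e))\<^sup>2 + (b (snd e))\<^sup>2) / 2))"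
proof -
  let ?\<Phi> = "\<lambda>\<rho>. \<Sum>e\<in>D. A e * \<rho> e"
  obtain \<rho> where \<rho>: "\<rho> \<in> closure unit_kernels"
    and max: "\<And>\<sigma>. \<sigma> \<in> closure unit_kernels \<Longrightarrow> ?\<Phi> \<sigma> \<le> ?\<Phi> \<rho>"
    using continuous_attains_sup[OF compact_closure_unit_kernels _ continuous_on_sum_kernel[where D=D and A=A]]
      unit_kernels_nonempty by auto
  define F where "F = ?\<Phi> \<rho>"
  have F: "?\<Phi> \<sigma> \<le> F" if "\<sigma> \<in> unit_kernels" for \<sigma>
    unfolding F_def using that closure_subset by (intro max) blast
  have "\<tau> * ?\<Phi> \<sigma> \<le> exp \<tau> * L + F * (sinh \<tau> - \<tau>)" if "\<sigma> \<in> unit_kernels" for \<sigma>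
  proof -
    have "\<tau> * ?\<Phi> \<sigma> \<le> (\<Sum>e\<in>D. A e * sinh (\<tau> * \<sigma> e)) + F * (sinh \<tau> - \<tau>)"
      using F that \<tau> by (rule sum_kernel_le_sinh)
    moreover have "(\<Sum>e\<in>D. A e * sinh (\<tau> * \<sigma> e)) \<le> exp \<tau> * L"
      using L that \<tau> by (rule sum_sinh_le)
    ultimately show ?thesis by linarith
  qed
  \<comment> \<open>The maximiser is only a limit of kernels, so the bound is first carried over to
    the closure.\<close>
  then have "unit_kernels \<subseteq> {\<sigma>. \<tau> * ?\<Phi> \<sigma> \<le> exp \<tau> * L + F * (sinh \<tau> - \<tau>)}" by blast
  moreover have "closed {\<sigma>. \<tau> * ?\<Phi> \<sigma> \<le> exp \<tau> * L + F * (sinh \<tau> - \<tau>)}"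
    by (intro closed_Collect_le continuous_intros continuous_on_sum_kernel)
  ultimately have "closure unit_kernels \<subseteq> {\<sigma>. \<tau> * ?\<Phi> \<sigma> \<le> exp \<tau> * L + F * (sinh \<tau> - \<tau>)}"
    by (rule closure_minimal)
  then have "\<tau> * F \<le> exp \<tau> * L + F * (sinh \<tau> - \<tau>)" using \<rho> unfolding F_def by blast
  then have 1: "(\<Sum>e\<in>D. A e * \<rho> e) * (2 * \<tau> - sinh \<tau>) \<le> exp \<tau> * L"
    unfolding F_def[symmetric] by (simp add: algebra_simps)
  have 2: "(\<Sum>e\<in>D. A e * a (fst e) * b (snd e)) \<le> (\<Sum>e\<in>D. A e * \<rho> e * (((a (fst e))\<^sup>2 + (b (snd e))\<^sup>2) / 2))" for a b
  proof -
    define V where "V \<epsilon> \<sigma> = (\<lambda>e. (\<sigma> e + \<epsilon> * (a (fst e) * b (snd e))) /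
        (sqrt (1 + \<epsilon> * (a (fst e))\<^sup>2) * sqrt (1 + \<epsilon> * (b (snd e))\<^sup>2)))" for \<epsilon> :: real and \<sigma> :: "nat \<times> nat \<Rightarrow> real"
    \<comment> \<open>For fixed \<open>\<epsilon>\<close> the perturbation is continuous and
      preserves kernels, hence it preserves their closure.\<close>
    have V: "V \<epsilon> \<rho> \<in> closure unit_kernels" if "\<epsilon> \<ge> 0" for \<epsilon>
    proof -
      have "continuous_on (closure unit_kernels) (V \<epsilon>)"
        unfolding V_def divide_inverse
        by (intro continuous_on_coordinatewise_then_product continuous_intros
            continuous_on_subset[OF continuous_on_product_coordinates subset_UNIV])
      then have "V \<epsilon> ` closure unit_kernels \<subseteq> closure unit_kernels"
      proof (rule image_closure_subset)
        show "V \<epsilon> ` unit_kernels \<subseteq> closure unit_kernels"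
          unfolding V_def using unit_kernels_perturb[OF _ that] closure_subset by blast
      qed simp
      then show ?thesis using \<rho> by blast
    qed
    define g where "g \<epsilon> = ?\<Phi> (V \<epsilon> \<rho>)" for \<epsilon>
    let ?d = "\<Sum>e\<in>D. A e * (a (fst e) * b (snd e) - \<rho> e * (((a (fst e))\<^sup>2 + (b (snd e))\<^sup>2) / 2))"
    have deriv: "(g has_real_derivative ?d) (at 0)"
      unfolding g_def V_def by (intro DERIV_sum DERIV_cmult deriv_normalised_perturbation)
    \<comment> \<open>Only \<open>\<epsilon> \<ge> 0\<close> is admissible, so maximality gives a
      sign for the derivative rather than its vanishing.\<close>
    have "?d \<le> 0"
    proof (rule ccontr)
      assume "\<not> ?d \<le> 0"
      then obtain \<delta> where "\<delta> > 0" "\<And>h. h > 0 \<Longrightarrow> h < \<delta> \<Longrightarrow> g 0 < g (0 + h)"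
        using DERIV_pos_inc_right[OF deriv] by auto
      then have "g 0 < g (\<delta> / 2)" using \<open>\<delta> > 0\<close> by force
      moreover have "g (\<delta> / 2) \<le> ?\<Phi> \<rho>" unfolding g_def using \<open>\<delta> > 0\<close> by (intro max V) simp
      moreover have "g 0 = ?\<Phi> \<rho>" by (simp add: g_def V_def)
      ultimately show False by simp
    qed
    then show ?thesis by (simp add: right_diff_distrib sum_subtractf mult.assoc)
  qed
  show ?thesis using that[of "\<lambda>e. A e * \<rho> e", OF 1 2] .
qed

section \<open>Lower bounds for Schur multipliers\<close>

text \<open>The phase of the form is moved into \<open>x\<close>; its real part is then the sum of
  the real forms at the real and at the imaginary parts, whose squares add up to those of the
  moduli.\<close>

lemma mat_norm_le_1_of_real_forms:
  fixes S :: "nat \<Rightarrow> nat \<Rightarrow> real"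
  assumes S: "\<And>n \<alpha> \<beta>. (\<Sum>i<n. \<Sum>j<n. S i j * \<alpha> i * \<beta> j) \<le> ((\<Sum>i<n. (\<alpha> i)\<^sup>2) + (\<Sum>j<n. (\<beta> j)\<^sup>2)) / 2"
  shows "mat_norm (\<lambda>i j. of_real (S i j)) \<le> 1"
  unfolding one_ereal_def mat_norm_le_iff
proof (intro allI impI)
  fix n and x y :: "nat \<Rightarrow> complex"
  assume x: "(\<Sum>j<n. (cmod (x j))\<^sup>2) \<le> 1" and y: "(\<Sum>i<n. (cmod (y i))\<^sup>2) \<le> 1"
  define z where "z = (\<Sum>i<n. \<Sum>j<n. cnj (y i) * of_real (S i j) * x j)"
  obtain u where u: "cmod u = 1" "of_real (cmod z) = u * z"
  proof (cases "z = 0")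
    case False
    then show ?thesis
      by (intro that[of "of_real (cmod z) / z"]) (simp_all add: norm_divide)
  qed (use that[of 1] in simp)
  define x' where "x' j = u * x j" for j
  have x': "(\<Sum>j<n. (cmod (x' j))\<^sup>2) \<le> 1" using x u by (simp add: x'_def norm_mult)
  have "cmod z = Re (u * z)" using u(2) by (metis Re_complex_of_real)
  also have "u * z = (\<Sum>i<n. \<Sum>j<n. cnj (y i) * of_real (S i j) * x' j)"
    by (simp add: z_def x'_def sum_distrib_left mult_ac)
  also have "Re \<dots> = (\<Sum>i<n. \<Sum>j<n. S i j * Re (y i) * Re (x' j)) + (\<Sum>i<n. \<Sum>j<n. S i j * Im (y i) * Im (x' j))"
    by (simp add: Re_sum sum.distrib[symmetric] algebra_simps)
  also have "\<dots> \<le> ((\<Sum>i<n. (Re (y i))\<^sup>2) + (\<Sum>j<n. (Re (x' j))\<^sup>2)) / 2 +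
      ((\<Sum>i<n. (Im (y i))\<^sup>2) + (\<Sum>j<n. (Im (x' j))\<^sup>2)) / 2"
    by (intro add_mono S)
  also have "\<dots> = ((\<Sum>i<n. (cmod (y i))\<^sup>2) + (\<Sum>j<n. (cmod (x' j))\<^sup>2)) / 2"
    by (simp add: cmod_power2 sum.distrib field_simps)
  also have "\<dots> \<le> 1" using x' y by simp
  finally show "cmod (\<Sum>i<n. \<Sum>j<n. cnj (y i) * of_real (S i j) * x j) \<le> 1" by (simp add: z_def)
qed

lemma sum_square_eq_sum_support:
  fixes f :: "nat \<Rightarrow> nat \<Rightarrow> 'a::comm_monoid_add"
  assumes "finite D" "\<And>i j. i < n \<Longrightarrow> j < n \<Longrightarrow> (i, j) \<notin> D \<Longrightarrow> f i j = 0"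
    "\<And>i j. (i, j) \<in> D \<Longrightarrow> \<not> (i < n \<and> j < n) \<Longrightarrow> g (i, j) = 0"
    "\<And>i j. (i, j) \<in> D \<Longrightarrow> i < n \<Longrightarrow> j < n \<Longrightarrow> f i j = g (i, j)"
  shows "(\<Sum>i<n. \<Sum>j<n. f i j) = (\<Sum>e\<in>D. g e)"
  unfolding sum.cartesian_product
  by (rule sum.mono_neutral_cong) (use assms in auto)

text \<open>Dividing by the roots of the row and column weights turns the hypothesis into
  contractivity of \<open>S\<close>. Since \<open>S\<close> vanishes off \<open>D\<close>, the
  values of \<open>X\<close> there are arbitrary.\<close>

lemma schur_norm_ge_of_weights:
  fixes A w :: "nat \<times> nat \<Rightarrow> real"
  assumes D: "finite D" "D \<noteq> {}" and A: "\<And>e. A e \<in> {-1, 1}"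
    and w: "\<And>a b. (\<Sum>e\<in>D. A e * a (fst e) * b (snd e)) \<le> (\<Sum>e\<in>D. w e * (((a (fst e))\<^sup>2 + (b (snd e))\<^sup>2) / 2))"
    and X: "\<And>i j. (i, j) \<in> D \<Longrightarrow> X i j = of_real (A (i, j))"
  shows "(\<Sum>e\<in>D. w e) > 0" "ereal (real (card D) / (\<Sum>e\<in>D. w e)) \<le> schur_norm X"
proof -
  define R where "R = fst ` D"
  define C where "C = snd ` D"
  define \<kappa> where "\<kappa> i = (\<Sum>e | e \<in> D \<and> fst e = i. w e)" for i
  define \<mu> where "\<mu> j = (\<Sum>e | e \<in> D \<and> snd e = j. w e)" for j
  define F where "F = (\<Sum>e\<in>D. w e)"
  have fin: "finite R" "finite C" using D by (auto simp: R_def C_def)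
  have A2: "A e * A e = 1" for e using A[of e] by auto
  have F\<kappa>: "F = (\<Sum>i\<in>R. \<kappa> i)"
    using sum_fibres[OF D(1), of w "\<lambda>_. 1" fst] by (simp add: F_def R_def \<kappa>_def)
  have F\<mu>: "F = (\<Sum>j\<in>C. \<mu> j)"
    using sum_fibres[OF D(1), of w "\<lambda>_. 1" snd] by (simp add: F_def C_def \<mu>_def)
  have ineq: "(\<Sum>e\<in>D. A e * a (fst e) * b (snd e)) \<le> ((\<Sum>i\<in>R. \<kappa> i * (a i)\<^sup>2) + (\<Sum>j\<in>C. \<mu> j * (b j)\<^sup>2)) / 2" for a b
  proof -
    have "(\<Sum>e\<in>D. w e * (((a (fst e))\<^sup>2 + (b (snd e))\<^sup>2) / 2)) =
       ((\<Sum>e\<in>D. w e * (a (fst e))\<^sup>2) + (\<Sum>e\<in>D. w e * (b (snd e))\<^sup>2)) / 2"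
      by (simp add: sum.distrib[symmetric] sum_divide_distrib distrib_left add_divide_distrib)
    also have "(\<Sum>e\<in>D. w e * (a (fst e))\<^sup>2) = (\<Sum>i\<in>R. \<kappa> i * (a i)\<^sup>2)"
      unfolding R_def \<kappa>_def by (rule sum_fibres[OF D(1), where b="\<lambda>i. (a i)\<^sup>2"])
    also have "(\<Sum>e\<in>D. w e * (b (snd e))\<^sup>2) = (\<Sum>j\<in>C. \<mu> j * (b j)\<^sup>2)"
      unfolding C_def \<mu>_def by (rule sum_fibres[OF D(1), where b="\<lambda>i. (b i)\<^sup>2"])
    finally show ?thesis using w[of a b] by simp
  qed
  \<comment> \<open>Vectors supported at one row and one column isolate one entry; the factor
    \<open>A (i, j)\<close> in \<open>b\<close> cancels its sign.\<close>
  have test: "s * t \<le> (\<kappa> i * s\<^sup>2 + \<mu> j * t\<^sup>2) / 2" if "(i, j) \<in> D" for i j s t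
  proof -
    define a where "a k = (if k = i then s else 0)" for k
    define b where "b k = (if k = j then t * A (i, j) else 0)" for k
    have "(\<Sum>e\<in>D. A e * a (fst e) * b (snd e)) = (\<Sum>e\<in>D. if e = (i, j) then s * t else 0)"
      by (intro sum.cong) (auto simp: a_def b_def A2 mult_ac)
    then have 1: "(\<Sum>e\<in>D. A e * a (fst e) * b (snd e)) = s * t" using D that by simp
    have "\<kappa> k * (a k)\<^sup>2 = (if k = i then \<kappa> i * s\<^sup>2 else 0)" for k by (simp add: a_def)
    then have 2: "(\<Sum>k\<in>R. \<kappa> k * (a k)\<^sup>2) = \<kappa> i * s\<^sup>2"
      using fin that by (simp add: R_def rev_image_eqI)
    have "\<mu> k * (b k)\<^sup>2 = (if k = j then \<mu> j * t\<^sup>2 else 0)" for k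
      using A2[of "(i, j)"] by (simp add: b_def power2_eq_square mult_ac)
    then have 3: "(\<Sum>k\<in>C. \<mu> k * (b k)\<^sup>2) = \<mu> j * t\<^sup>2"
      using fin that by (simp add: C_def rev_image_eqI)
    show ?thesis using ineq[of a b] unfolding 1 2 3 .
  qed
  have \<kappa>pos: "\<kappa> i > 0" if ij: "(i, j) \<in> D" for i j
  proof (rule ccontr)
    assume "\<not> \<kappa> i > 0"
    \<comment> \<open>With \<open>s = \<bar>\<mu> j\<bar> + 1\<close> and \<open>t = 1\<close>,
      \<open>test\<close> would give \<open>s \<le> \<mu> j / 2\<close>.\<close>
    then have "\<kappa> i * (\<bar>\<mu> j\<bar> + 1)\<^sup>2 \<le> 0" by (simp add: mult_nonpos_nonneg)
    then show False using test[OF ij, of "\<bar>\<mu> j\<bar> + 1" 1] by simp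
  qed
  have \<mu>pos: "\<mu> j > 0" if ij: "(i, j) \<in> D" for i j
  proof (rule ccontr)
    assume "\<not> \<mu> j > 0"
    then have "\<mu> j * (\<bar>\<kappa> i\<bar> + 1)\<^sup>2 \<le> 0" by (simp add: mult_nonpos_nonneg)
    then show False using test[OF ij, of 1 "\<bar>\<kappa> i\<bar> + 1"] by simp
  qed
  have \<kappa>R: "\<kappa> i > 0" if "i \<in> R" for i using that \<kappa>pos by (auto simp: R_def)
  have \<mu>C: "\<mu> j > 0" if "j \<in> C" for j using that \<mu>pos by (auto simp: C_def)
  have F: "F > 0" unfolding F\<kappa> using D fin \<kappa>R by (intro sum_pos) (auto simp: R_def)
  then show "(\<Sum>e\<in>D. w e) > 0" by (simp add: F_def)
  define S where "S i j = (if (i, j) \<in> D then A (i, j) / (sqrt (\<kappa> i) * sqrt (\<mu> j)) else 0)" for i j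
  have "mat_norm (\<lambda>i j. of_real (S i j)) \<le> 1"
  proof (rule mat_norm_le_1_of_real_forms)
    fix n and \<alpha> \<beta> :: "nat \<Rightarrow> real"
    \<comment> \<open>Coefficients outside the \<open>n\<close> by \<open>n\<close> corner are set
      to zero, as \<open>D\<close> may extend beyond it.\<close>
    define a where "a i = (if i < n then \<alpha> i / sqrt (\<kappa> i) else 0)" for i
    define b where "b j = (if j < n then \<beta> j / sqrt (\<mu> j) else 0)" for j
    have "(\<Sum>i<n. \<Sum>j<n. S i j * \<alpha> i * \<beta> j) = (\<Sum>e\<in>D. A e * a (fst e) * b (snd e))"
      by (rule sum_square_eq_sum_support[OF D(1)]) (auto simp: S_def a_def b_def)
    also have "\<dots> \<le> ((\<Sum>i\<in>R. \<kappa> i * (a i)\<^sup>2) + (\<Sum>j\<in>C. \<mu> j * (b j)\<^sup>2)) / 2" by (rule ineq)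
    also have "\<dots> \<le> ((\<Sum>i<n. (\<alpha> i)\<^sup>2) + (\<Sum>j<n. (\<beta> j)\<^sup>2)) / 2"
    proof (intro divide_right_mono add_mono)
      have "(\<Sum>i\<in>R. \<kappa> i * (a i)\<^sup>2) = (\<Sum>i\<in>R. if i < n then (\<alpha> i)\<^sup>2 else 0)"
        using \<kappa>R by (intro sum.cong) (auto simp: a_def power_divide less_imp_le less_imp_neq[symmetric])
      also have "\<dots> = (\<Sum>i\<in>R \<inter> {..<n}. (\<alpha> i)\<^sup>2)"
        using fin by (simp add: sum.inter_restrict)
      also have "\<dots> \<le> (\<Sum>i<n. (\<alpha> i)\<^sup>2)" by (rule sum_mono2) auto
      finally show "(\<Sum>i\<in>R. \<kappa> i * (a i)\<^sup>2) \<le> (\<Sum>i<n. (\<alpha> i)\<^sup>2)" .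
      have "(\<Sum>j\<in>C. \<mu> j * (b j)\<^sup>2) = (\<Sum>j\<in>C. if j < n then (\<beta> j)\<^sup>2 else 0)"
        using \<mu>C by (intro sum.cong) (auto simp: b_def power_divide less_imp_le less_imp_neq[symmetric])
      also have "\<dots> = (\<Sum>j\<in>C \<inter> {..<n}. (\<beta> j)\<^sup>2)"
        using fin by (simp add: sum.inter_restrict)
      also have "\<dots> \<le> (\<Sum>j<n. (\<beta> j)\<^sup>2)" by (rule sum_mono2) auto
      finally show "(\<Sum>j\<in>C. \<mu> j * (b j)\<^sup>2) \<le> (\<Sum>j<n. (\<beta> j)\<^sup>2)" .
    qed simp
    finally show "(\<Sum>i<n. \<Sum>j<n. S i j * \<alpha> i * \<beta> j) \<le> ((\<Sum>i<n. (\<alpha> i)\<^sup>2) + (\<Sum>j<n. (\<beta> j)\<^sup>2)) / 2" .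
  qed
  then have "mat_norm (\<lambda>i j. X i j * of_real (S i j)) \<le> schur_norm X" by (rule schur_norm_ge)
  moreover have "ereal (real (card D) / F) \<le> mat_norm (\<lambda>i j. X i j * of_real (S i j))"
  proof -
    obtain n where n: "R \<union> C \<subseteq> {..<n}"
      using finite_nat_iff_bounded[of "R \<union> C"] fin by auto
    define y where "y i = (if i \<in> R then sqrt (\<kappa> i) / sqrt F else 0)" for i
    define x where "x j = (if j \<in> C then sqrt (\<mu> j) / sqrt F else 0)" for j
    have "(\<Sum>i<n. (y i)\<^sup>2) = (\<Sum>i\<in>R. \<kappa> i / F)"
      using n fin \<kappa>R F by (intro sum.mono_neutral_cong_right)
        (auto simp: y_def power_divide less_imp_le)
    then have y: "(\<Sum>i<n. (y i)\<^sup>2) = 1" using F by (simp add: sum_divide_distrib[symmetric] F\<kappa>[symmetric])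
    have "(\<Sum>j<n. (x j)\<^sup>2) = (\<Sum>j\<in>C. \<mu> j / F)"
      using n fin \<mu>C F by (intro sum.mono_neutral_cong_right)
        (auto simp: x_def power_divide less_imp_le)
    then have x: "(\<Sum>j<n. (x j)\<^sup>2) = 1" using F by (simp add: sum_divide_distrib[symmetric] F\<mu>[symmetric])
    have "(\<Sum>i<n. \<Sum>j<n. cnj (of_real (y i)) * (X i j * of_real (S i j)) * of_real (x j)) =
        (\<Sum>e\<in>D. complex_of_real (1 / F))"
    proof (rule sum_square_eq_sum_support[OF D(1)])
      fix i j assume ij: "(i, j) \<in> D"
      then have "i \<in> R" "j \<in> C" by (auto simp: R_def C_def rev_image_eqI)
      then show "of_real (1 / F) = (0::complex)" if "\<not> (i < n \<and> j < n)" using n that by auto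
      have "sqrt (\<kappa> i) > 0" "sqrt (\<mu> j) > 0" using \<kappa>pos[OF ij] \<mu>pos[OF ij] by auto
      \<comment> \<open>The weights cancel, so every element of \<open>D\<close> contributes the
        same amount \<open>1 / F\<close>.\<close>
      then have "y i * (A (i, j) * S i j) * x j = A (i, j) * A (i, j) / (sqrt F * sqrt F)"
        using ij \<open>i \<in> R\<close> \<open>j \<in> C\<close> by (simp add: y_def x_def S_def)
      also have "\<dots> = 1 / F" using F by (simp add: A2)
      finally show "cnj (of_real (y i)) * (X i j * of_real (S i j)) * of_real (x j) = of_real (1 / F)"
        unfolding X[OF ij] by (metis complex_cnj_complex_of_real of_real_mult)
    qed (simp add: S_def)
    also have "\<dots> = of_real (real (card D) / F)" by simp
    finally have "cmod (\<Sum>i<n. \<Sum>j<n. cnj (of_real (y i)) * (X i j * of_real (S i j)) * of_real (x j)) = real (card D) / F"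
      using F by (simp add: norm_divide)
    then show ?thesis
      using mat_norm_ge_form[where n=n and x="\<lambda>j. of_real (x j)" and y="\<lambda>i. of_real (y i)"
          and T="\<lambda>i j. X i j * of_real (S i j)"] x y by simp
  qed
  ultimately show "ereal (real (card D) / (\<Sum>e\<in>D. w e)) \<le> schur_norm X" unfolding F_def by (rule order_trans[rotated])
qed

section \<open>Numerical constants and finite patterns\<close>

text \<open>Fourth powers reduce the first bound to \<open>2.72 ^ 3 \<le> 2.12 ^ 4\<close>; the
  second follows from it.\<close>

lemma exp_sinh_three_quarters:
  shows "exp (3/4::real) \<le> 53/25" "sinh (3/4::real) \<le> 0.825"
proof -
  have "exp (3/4::real) ^ 4 = exp 1 ^ 3"
    by (simp flip: exp_of_nat_mult)
  also have "\<dots> \<le> (272/100) ^ 3" using e_less_272 by (intro power_mono) auto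
  also have "\<dots> \<le> (53/25::real) ^ 4" by (simp add: power_divide)
  finally show *: "exp (3/4::real) \<le> 53/25" by (rule power_le_imp_le_base[of _ 3, simplified]) simp_all
  have "25/53 \<le> exp (- (3/4::real))"
    using le_imp_inverse_le[OF *] by (simp add: exp_minus)
  then show "sinh (3/4::real) \<le> 0.825" using * unfolding sinh_def by simp
qed

text \<open>As \<open>X\<close> is prescribed on \<open>D\<close> only, one matrix can serve
  infinitely many disjoint \<open>D\<close> at once.\<close>

lemma exists_signs_schur_norm_ge:
  fixes D :: "(nat \<times> nat) set"
  assumes D: "finite D" "D \<noteq> {}"
  shows "\<exists>A. (\<forall>e. A e \<in> {-1, 1::real}) \<and> (\<forall>X. (\<forall>i j. (i, j) \<in> D \<longrightarrow> X i j = of_real (A (i, j))) \<longrightarrow>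
    ereal (sqrt (real (card D) / (15 * real (card (fst ` D) + card (snd ` D))))) \<le> schur_norm X)"
proof -
  define N where "N = real (card D)"
  define q where "q = real (card (fst ` D) + card (snd ` D))"
  define L where "L = sqrt (2 * ln 2 * N * q)"
  have N: "N > 0" using D by (simp add: N_def card_gt_0_iff)
  have q: "q > 0" using D by (simp add: q_def card_gt_0_iff add_pos_nonneg)
  obtain A where A: "\<And>e. A e \<in> {-1, 1::real}"
    and L: "\<And>a b. (\<And>i. \<bar>a i\<bar> \<le> 1) \<Longrightarrow> (\<And>j. \<bar>b j\<bar> \<le> 1) \<Longrightarrow> (\<Sum>e\<in>D. A e * a (fst e) * b (snd e)) \<le> L"
    using exists_signs_cut_norm[OF D] unfolding L_def N_def q_def by blast
  obtain w where w1: "(\<Sum>e\<in>D. w e) * (2 * (3/4) - sinh (3/4)) \<le> exp (3/4) * L"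
    and w2: "\<And>a b. (\<Sum>e\<in>D. A e * a (fst e) * b (snd e)) \<le> (\<Sum>e\<in>D. w e * (((a (fst e))\<^sup>2 + (b (snd e))\<^sup>2) / 2))"
    using grothendieck_factorisation[OF L, of "3/4"] by auto
  define F where "F = (\<Sum>e\<in>D. w e)"
  have F: "F > 0" unfolding F_def
    by (rule schur_norm_ge_of_weights(1)[OF D A w2, where X="\<lambda>i j. of_real (A (i, j))"]) auto
  have L0: "L \<ge> 0" using N q by (simp add: L_def)
  \<comment> \<open>Here \<open>0.675 = 1.5 - 0.825\<close>, and
    \<open>2.12 / 0.675 < 3.15\<close>.\<close>
  have "F * 0.675 \<le> F * (2 * (3/4) - sinh (3/4))"
    using F exp_sinh_three_quarters(2) by (intro mult_left_mono) auto
  also have "\<dots> \<le> exp (3/4) * L" using w1 by (simp only: F_def)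
  also have "\<dots> \<le> 53/25 * L" using L0 exp_sinh_three_quarters(1) by (intro mult_right_mono)
  finally have "F \<le> 3.15 * L" using L0 by simp
  then have "F\<^sup>2 \<le> (3.15 * L)\<^sup>2" using F by (intro power_mono) auto
  also have "\<dots> = 3.15\<^sup>2 * 2 * ln 2 * (N * q)"
    using N q by (simp only: power_mult_distrib L_def) simp
  \<comment> \<open>With \<open>ln 2 \<le> 25/36\<close> the constant is below \<open>14\<close>;
    any bound below \<open>16\<close> leaves room for the final \<open>1/4\<close>.\<close>
  also have "\<dots> \<le> 15 * (N * q)"
    using N q ln2_le_25_over_36 by (intro mult_right_mono) (auto simp: power2_eq_square)
  finally have F2: "F\<^sup>2 \<le> 15 * (N * q)" .
  have "sqrt (N / (15 * q)) \<le> N / F"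
  proof (rule real_le_lsqrt)
    have "N * F\<^sup>2 \<le> N * (15 * (N * q))" using F2 N by (intro mult_left_mono) auto
    then show "N / (15 * q) \<le> (N / F)\<^sup>2"
      using N q F by (simp add: power_divide divide_simps power2_eq_square mult_ac)
  qed (use N q F in auto)
  moreover have "ereal (N / F) \<le> schur_norm X" if "\<forall>i j. (i, j) \<in> D \<longrightarrow> X i j = of_real (A (i, j))" for X
    unfolding N_def F_def using schur_norm_ge_of_weights(2)[OF D A w2] that by blast
  ultimately have "ereal (sqrt (N / (15 * q))) \<le> schur_norm X"
    if "\<forall>i j. (i, j) \<in> D \<longrightarrow> X i j = of_real (A (i, j))" for X
    using that by (meson ereal_less_eq(3) order_trans)
  then show ?thesis using A unfolding N_def q_def by blast
qed

section \<open>Characterisation of Schur bounded patterns\<close>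

text \<open>A rectangle violating the density bound still does so after shrinking to the rows and
  columns its elements occupy.\<close>

lemma schur_bound_ge:
  assumes "\<not> pattern_density P \<le> ereal (real k)"
  shows "ereal (sqrt (real k / 15)) \<le> schur_bound P"
proof -
  obtain R C where fin: "finite R" "finite C" and gt: "card (P \<inter> (R \<times> C)) > k * (card R + card C)"
    using assms unfolding pattern_density_le_iff by (auto simp: not_le)
  define D where "D = P \<inter> (R \<times> C)"
  define q where "q = card (fst ` D) + card (snd ` D)"
  have D: "finite D" "D \<noteq> {}" using fin gt by (auto simp: D_def)
  have "q \<le> card R + card C"
    unfolding q_def using fin by (intro add_mono card_mono) (auto simp: D_def)
  then have "k * q \<le> k * (card R + card C)" by simp
  then have "k * q \<le> card D" using gt unfolding D_def by linarith
  then have "real k * real q \<le> real (card D)" by (metis of_nat_le_iff of_nat_mult)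
  moreover have "q > 0" using D by (simp add: q_def card_gt_0_iff)
  ultimately have le: "real k / 15 \<le> real (card D) / (15 * real q)" by (simp add: field_simps)
  obtain A where A: "\<And>e. A e \<in> {-1, 1::real}"
    and ge: "\<And>X. \<forall>i j. (i, j) \<in> D \<longrightarrow> X i j = of_real (A (i, j)) \<Longrightarrow>
      ereal (sqrt (real (card D) / (15 * real q))) \<le> schur_norm X"
    using exists_signs_schur_norm_ge[OF D] unfolding q_def by blast
  define X :: cmat where "X i j = (if (i, j) \<in> D then of_real (A (i, j)) else 0)" for i j
  have "\<bar>A e\<bar> = 1" for e using A[of e] by auto
  then have "X \<in> schur_class P" by (auto simp: schur_class_def supported_on_def X_def D_def)
  then have "schur_norm X \<le> schur_bound P" unfolding schur_bound_def by (rule SUP_upper)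
  moreover have "ereal (sqrt (real (card D) / (15 * real q))) \<le> schur_norm X"
    by (rule ge) (simp add: X_def)
  moreover have "ereal (sqrt (real k / 15)) \<le> ereal (sqrt (real (card D) / (15 * real q)))"
    using le by simp
  ultimately show ?thesis by order
qed

text \<open>Deleting \<open>U\<close> loses at most \<open>card U\<close> elements, which is paid
  for by starting from density above \<open>n + card U\<close>.\<close>

lemma exists_dense_subset:
  assumes "\<And>k::nat. \<not> pattern_density P \<le> ereal (real k)" "finite U"
  shows "\<exists>D. finite D \<and> D \<subseteq> P - U \<and> D \<noteq> {} \<and> n * (card (fst ` D) + card (snd ` D)) \<le> card D"
proof -
  obtain R C where fin: "finite R" "finite C"
    and gt: "card (P \<inter> (R \<times> C)) > (n + card U) * (card R + card C)"
    using assms(1)[of "n + card U"] unfolding pattern_density_le_iff by (auto simp: not_le)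
  define D where "D = P \<inter> (R \<times> C) - U"
  have "card R + card C > 0" using gt fin by (auto simp: card_gt_0_iff intro: ccontr)
  then have "card U * 1 \<le> card U * (card R + card C)" by (intro mult_le_mono2) linarith
  moreover have "card (P \<inter> (R \<times> C)) - card U \<le> card D"
    unfolding D_def using assms(2) by (rule diff_card_le_card_Diff)
  ultimately have lt: "n * (card R + card C) < card D" using gt unfolding add_mult_distrib by linarith
  have "card (fst ` D) + card (snd ` D) \<le> card R + card C"
    using fin by (intro add_mono card_mono) (auto simp: D_def)
  then have "n * (card (fst ` D) + card (snd ` D)) \<le> n * (card R + card C)" by simp
  then have "n * (card (fst ` D) + card (snd ` D)) \<le> card D" using lt by linarith
  moreover have "D \<noteq> {}" using lt by auto
  moreover have "finite D" "D \<subseteq> P - U" using fin by (auto simp: D_def)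
  ultimately show ?thesis by blast
qed

text \<open>Disjoint finite pieces \<open>D n\<close> of density at least \<open>15 * n * n\<close>
  are chosen successively. One matrix carrying good signs on all of them has Schur norm at least
  every \<open>n\<close>.\<close>

lemma not_schur_bounded_of_infinite_density:
  assumes "\<And>k::nat. \<not> pattern_density P \<le> ereal (real k)"
  shows "\<not> schur_bounded P"
proof -
  \<comment> \<open>\<open>U\<close> collects the elements used so far, and \<open>V - U\<close> is
    the next piece.\<close>
  let ?Q = "\<lambda>n U V. U \<subseteq> V \<and> V - U \<subseteq> P \<and> V - U \<noteq> {} \<and>
      15 * n * n * (card (fst ` (V - U)) + card (snd ` (V - U))) \<le> card (V - U)"
  have "\<exists>U. \<forall>n. finite (U n) \<and> ?Q n (U n) (U (Suc n))"
  proof (rule dependent_nat_choice)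
    fix U :: "(nat \<times> nat) set" and n assume U: "finite U"
    obtain D where D: "finite D" "D \<subseteq> P - U" "D \<noteq> {}"
      "15 * n * n * (card (fst ` D) + card (snd ` D)) \<le> card D"
      using exists_dense_subset[OF assms U, of "15 * n * n"] by blast
    moreover have "(U \<union> D) - U = D" using D by blast
    ultimately show "\<exists>V. finite V \<and> ?Q n U V" using U by (intro exI[of _ "U \<union> D"]) auto
  qed blast
  then obtain U where fin: "\<And>n. finite (U n)" and Q: "\<And>n. ?Q n (U n) (U (Suc n))" by blast
  define D where "D n = U (Suc n) - U n" for n
  have D: "finite (D n)" "D n \<subseteq> P" "D n \<noteq> {}"
      "15 * n * n * (card (fst ` D n) + card (snd ` D n)) \<le> card (D n)" for n
    using fin Q[of n] by (auto simp: D_def)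
  have mono: "U k \<subseteq> U n" if "k \<le> n" for k n
    using lift_Suc_mono_le[of U, OF _ that] Q by blast
  have disj: "k = n" if "e \<in> D k" "e \<in> D n" for k n e
  proof (rule ccontr)
    assume "k \<noteq> n"
    then have "Suc k \<le> n \<or> Suc n \<le> k" by linarith
    then show False using mono[of "Suc k" n] mono[of "Suc n" k] that by (auto simp: D_def)
  qed
  have "\<exists>A. (\<forall>e. A e \<in> {-1, 1::real}) \<and> (\<forall>X. (\<forall>i j. (i, j) \<in> D n \<longrightarrow> X i j = of_real (A (i, j))) \<longrightarrow>
      ereal (sqrt (real (card (D n)) / (15 * real (card (fst ` D n) + card (snd ` D n))))) \<le> schur_norm X)" for n
    by (rule exists_signs_schur_norm_ge) (rule D)+
  then obtain A where A: "\<And>n e. A n e \<in> {-1, 1::real}"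
    and ge: "\<And>n X. \<forall>i j. (i, j) \<in> D n \<longrightarrow> X i j = of_real (A n (i, j)) \<Longrightarrow>
      ereal (sqrt (real (card (D n)) / (15 * real (card (fst ` D n) + card (snd ` D n))))) \<le> schur_norm X"
    by metis
  \<comment> \<open>Disjointness of the pieces makes the index under \<open>THE\<close>
    unique.\<close>
  define X :: cmat where
    "X i j = (if \<exists>n. (i, j) \<in> D n then of_real (A (THE n. (i, j) \<in> D n) (i, j)) else 0)" for i j
  have X: "X i j = of_real (A n (i, j))" if "(i, j) \<in> D n" for i j n
  proof -
    have "(THE n. (i, j) \<in> D n) = n" using that disj by blast
    then show ?thesis using that by (auto simp: X_def)
  qed
  have "\<bar>A n e\<bar> = 1" for n e using A[of n e] by auto
  then have "X \<in> schur_class P" using D(2) by (fastforce simp: schur_class_def supported_on_def X_def)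
  moreover have "ereal (real n) \<le> schur_norm X" for n
  proof -
    define q where "q = card (fst ` D n) + card (snd ` D n)"
    have q: "q > 0" using D(1,3)[of n] by (simp add: q_def card_gt_0_iff)
    have "real (15 * n * n * q) \<le> real (card (D n))" using D(4)[of n] unfolding q_def of_nat_le_iff .
    then have "(real n)\<^sup>2 \<le> real (card (D n)) / (15 * real q)"
      using q by (simp add: field_simps power2_eq_square)
    then have "ereal (real n) \<le> ereal (sqrt (real (card (D n)) / (15 * real q)))"
      by (simp add: real_le_rsqrt)
    also have "\<dots> \<le> schur_norm X" unfolding q_def by (rule ge) (use X in blast)
    finally show ?thesis .
  qed
  then have "schur_norm X = \<infinity>"
    by (intro ereal_top) (meson ereal_less_eq(3) order_trans real_arch_simple)
  ultimately show ?thesis unfolding schur_bounded_def by force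
qed

theorem theorem2p3:
  fixes P :: "(nat \<times> nat) set"
  shows "(schur_bounded P \<longleftrightarrow> (\<exists>Q1 Q2. P = Q1 \<union> Q2 \<and> row_finite Q1 \<and> col_finite Q2))
       \<and> ((\<exists>Q1 Q2. P = Q1 \<union> Q2 \<and> row_finite Q1 \<and> col_finite Q2) \<longleftrightarrow> pattern_density P < \<infinity>)
       \<and> (\<forall>m::nat. pattern_density P < \<infinity> \<and> m = (LEAST k::nat. pattern_density P \<le> ereal (real k)) \<longrightarrow>
            (\<exists>Q1 Q2. P = Q1 \<union> Q2 \<and> row_bounded Q1 m \<and> col_bounded Q2 m)
            \<and> (\<forall>k::nat. (\<exists>Q1 Q2. P = Q1 \<union> Q2 \<and> row_bounded Q1 k \<and> col_bounded Q2 k) \<longrightarrow> m \<le> k)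
            \<and> ereal (sqrt (real m) / 4) \<le> schur_bound P
            \<and> schur_bound P \<le> ereal (2 * sqrt (real m)))"
proof -
  let ?dec = "\<lambda>k. \<exists>Q1 Q2. P = Q1 \<union> Q2 \<and> row_bounded Q1 k \<and> col_bounded Q2 k"
  have dec: "?dec k \<longleftrightarrow> pattern_density P \<le> ereal (real k)" for k
  proof
    assume "?dec k"
    then show "pattern_density P \<le> ereal (real k)" by (elim exE conjE) (rule pattern_density_le_of_union)
  qed (rule union_of_pattern_density_le)
  have fin_dec: "(\<exists>Q1 Q2. P = Q1 \<union> Q2 \<and> row_finite Q1 \<and> col_finite Q2) \<longleftrightarrow> (\<exists>k. ?dec k)"
  proof
    assume "\<exists>Q1 Q2. P = Q1 \<union> Q2 \<and> row_finite Q1 \<and> col_finite Q2"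
    then obtain Q1 Q2 k l where Q: "P = Q1 \<union> Q2" "row_bounded Q1 k" "col_bounded Q2 l"
      by (auto simp: row_finite_def col_finite_def)
    \<comment> \<open>The two finiteness bounds may differ; a common one is their maximum.\<close>
    then have "row_bounded Q1 (max k l)" "col_bounded Q2 (max k l)"
      by (auto simp: row_bounded_def col_bounded_def le_max_iff_disj)
    then show "\<exists>k. ?dec k" using Q(1) by blast
  next
    assume "\<exists>k. ?dec k"
    then show "\<exists>Q1 Q2. P = Q1 \<union> Q2 \<and> row_finite Q1 \<and> col_finite Q2"
      unfolding row_finite_def col_finite_def by blast
  qed
  have dens: "(\<exists>k::nat. pattern_density P \<le> ereal (real k)) \<longleftrightarrow> pattern_density P < \<infinity>"
  proof
    assume "pattern_density P < \<infinity>"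
    then obtain k :: nat where "pattern_density P < ereal (real k)"
      using less_PInf_Ex_of_nat[of "pattern_density P"] by auto
    then show "\<exists>k::nat. pattern_density P \<le> ereal (real k)" using less_imp_le by blast
  qed (auto intro: le_less_trans)
  have upper: "schur_norm X \<le> ereal (2 * sqrt (real k))" if "?dec k" "X \<in> schur_class P" for X k
    using that(1) by (elim exE conjE) (use that(2) in \<open>simp add: schur_norm_le_of_union\<close>)
  have bdd: "schur_bounded P \<longleftrightarrow> (\<exists>k. ?dec k)"
  proof
    assume "schur_bounded P"
    then show "\<exists>k. ?dec k" unfolding dec using not_schur_bounded_of_infinite_density[of P] by metis
  next
    assume "\<exists>k. ?dec k"
    then obtain k where "?dec k" ..
    show "schur_bounded P"
      unfolding schur_bounded_def
    proof
      fix X assume "X \<in> schur_class P"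
      then have "schur_norm X \<le> ereal (2 * sqrt (real k))" by (rule upper[OF \<open>?dec k\<close>])
      also have "\<dots> < \<infinity>" by simp
      finally show "schur_norm X < \<infinity>" .
    qed
  qed
  have main: "?dec m \<and> (\<forall>k. ?dec k \<longrightarrow> m \<le> k) \<and> ereal (sqrt (real m) / 4) \<le> schur_bound P
      \<and> schur_bound P \<le> ereal (2 * sqrt (real m))"
    if fin: "pattern_density P < \<infinity>" and m: "m = (LEAST k::nat. pattern_density P \<le> ereal (real k))" for m
  proof (intro conjI allI impI)
    show decm: "?dec m" unfolding dec m using fin dens by (metis LeastI_ex)
    show "m \<le> k" if "?dec k" for k using that unfolding dec m by (rule Least_le)
    show "schur_bound P \<le> ereal (2 * sqrt (real m))"
      unfolding schur_bound_def using upper[OF decm] by (rule SUP_least)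
    have not_le: "\<not> pattern_density P \<le> ereal (real k)" if "k < m" for k
      using that not_less_Least unfolding m by blast
    \<comment> \<open>Minimality gives density above \<open>m - 1\<close>, and the loss of one is
      affordable only for large \<open>m\<close>. Up to \<open>16\<close> the claimed bound is at
      most \<open>1\<close>.\<close>
    consider "m = 0" | "0 < m" "m \<le> 16" | "16 < m" by linarith
    then show "ereal (sqrt (real m) / 4) \<le> schur_bound P"
    proof cases
      case 1
      have "(\<lambda>_ _. 0) \<in> schur_class P" by (simp add: schur_class_def supported_on_def)
      then have "0 \<le> schur_bound P"
        unfolding schur_bound_def using schur_norm_nonneg by (rule SUP_upper2)
      then show ?thesis using 1 by (simp add: zero_ereal_def)
    next
      case 2
      have "P \<noteq> {}" using not_le[OF 2(1)] unfolding pattern_density_le_iff by auto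
      then obtain i j where ij: "(i, j) \<in> P" by auto
      define X :: cmat where "X k l = (if (k, l) = (i, j) then 1 else 0)" for k l
      have "X \<in> schur_class P" using ij by (auto simp: schur_class_def supported_on_def X_def)
      then have "schur_norm X \<le> schur_bound P" unfolding schur_bound_def by (rule SUP_upper)
      moreover have "ereal 1 \<le> schur_norm X" using schur_norm_ge_entry[of X i j] by (simp add: X_def)
      moreover have "sqrt (real m) \<le> sqrt (4\<^sup>2)" using 2 by (intro real_sqrt_le_mono) simp
      then have "ereal (sqrt (real m) / 4) \<le> ereal 1" by simp
      ultimately show ?thesis by order
    next
      case 3
      have "sqrt (real m) / 4 = sqrt (real m / 4\<^sup>2)" by (simp add: real_sqrt_divide)
      \<comment> \<open>This amounts to \<open>15 * m \<le> 16 * (m - 1)\<close>, that is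
        \<open>16 \<le> m\<close>.\<close>
      also have "\<dots> \<le> sqrt (real (m - 1) / 15)"
        using 3 by (intro real_sqrt_le_mono) (simp add: of_nat_diff)
      finally have "ereal (sqrt (real m) / 4) \<le> ereal (sqrt (real (m - 1) / 15))" by simp
      also have "\<dots> \<le> schur_bound P" using 3 by (intro schur_bound_ge not_le) simp
      finally show ?thesis .
    qed
  qed
  have dec_dens: "(\<exists>k. ?dec k) \<longleftrightarrow> pattern_density P < \<infinity>" unfolding dec by (rule dens)
  show ?thesis
    unfolding bdd fin_dec
    by (rule conjI[OF refl conjI[OF dec_dens allI[OF impI]]], elim conjE) (rule main)
qed

end
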